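(* For every positive integer $M$, the following diagrams commute: $$\mathcal M_{bc}\circ\mathbb B(x)=\mathbf B(x)\circ\mathcal M_{bc}\ \text{ as maps } \mathcal V\to\mathcal F^{(0)},\qquad \mathcal M^*_{bc}\big(\langle v|\,\mathbb C(x)\big)=\mathcal M^*_{bc}\big(\langle v|\big)\,\mathbf C(x)\ \text{ for all } \langle v|\in\mathcal V^*.$$
   Context: Phase model. $\mathcal V$ has basis $|\underline n\rangle=|n_0\rangle_0\otimes\cdots\otimes|n_M\rangle_M$ and $\mathcal V^*$ has basis $\langle\underline n|=\langle n_0|_0\otimes\cdots\otimes\langle n_M|_M$, with all $n_i\in\mathbb Z_{\ge0}$. Operators $\psi_i,\psi_i^\dagger$ ($0\le i\le M$) act on $\mathcal V$ by: $\psi_i$ lowers $n_i$ by $1$ (giving $0$ if $n_i=0$), $\psi_i^\dagger$ raises $n_i$ by $1$; they act from the right on $\mathcal V^*$ by: $\langle\underline n|\psi_i$ raises $n_i$ by $1$, $\langle\underline n|\psi_i^\dagger$ lowers $n_i$ by $1$ (giving $0$ if $n_i=0$). Let $$L_m(x)=\begin{pmatrix}x^{-1/2}&\psi_m^\dagger\\ \psi_m&x^{1/2}\end{pmatrix},\qquad T(x)=L_M(x)\cdots L_1(x)L_0(x)=\begin{pmatrix}A(x)&B(x)\\ C(x)&D(x)\end{pmatrix},$$ $\mathbb B(x)=x^{M/2}B(x)$ and $\mathbb C(x)=x^{M/2}C(1/x)$. Fermions. $b(i),c(i)$ ($i\in\mathbb Z$) satisfy $\{b(i),c(j)\}=\delta_{i,-j}$,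 $\{b(i),b(j)\}=\{c(i),c(j)\}=0$, where $\{A,B\}=AB+BA$. The vacuum satisfies $b(m+1)|0\rangle=c(m)|0\rangle=0$ for $m\ge 0$; the dual vacuum (generating a right module) satisfies $\langle 0|b(i+1)=\langle 0|c(i)=0$ for $i<0$. $\mathcal F^{(0)}$ and $\mathcal F^{*(0)}$ are the subspaces of the Fock space and dual Fock space spanned by monomials with equally many $b$'s and $c$'s applied to $|0\rangle$, $\langle0|$. $\mathbf B(x)$ is the ordered product of $\exp(x\,b(-(i-1))c(i-2))$, $i\le M$, with $i$ decreasing from left to right, acting on $\mathcal F^{(0)}$; $\mathbf C(x)$ is the ordered product of $\exp(x\,b(-i+2)c(i-1))$, $i\le M$, with $i$ decreasing from right to left, acting from the right on $\mathcal F^{*(0)}$; on each fixed vector all but finitely many factors act as the identity. For a partition $\mu=(\mu_1,\dots,\mu_l)$ with $m_i=\mu_i-i$: $|\mu)=b(-m_1)\cdots b(-m_l)c(-l)c(-l+1)\cdots c(-1)|0\rangle$ and $(\mu|=\langle0|b(1)b(2)\cdots b(l)c(m_l)\cdots c(m_1)$. The linear maps $\mathcal M_{bc}:\mathcal V\to\mathcal F^{(0)}$, $\mathcal M^*_{bc}:\mathcal V^*\to\mathcal F^{*(0)}$ are $\mathcal M_{bc}(|\underline n\rangle)=|\nu)$, $\mathcal M^*_{bc}(\langle\underline n|)=(\nu|$, where $\nu=(M^{n_M},\dots,2^{n_2},1^{n_1})$ is the partition with $n_i$ parts equal to $i$ ($1\le i\le M$). *)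

theory Defs
  imports
    "HOL-Analysis.Analysis"
    "HOL-Library.Poly_Mapping"
    "HOL-Library.FuncSet"
begin

section \<open>Free associative algebras\<close>

text \<open>
  With concatenation as addition on lists, \<^typ>\<open>'g list \<Rightarrow>\<^sub>0 'k\<close> carries the convolution product, so it
  is the free associative unital algebra over \<^typ>\<open>'k\<close> on the generators \<^typ>\<open>'g\<close>.
\<close>

instantiation list :: (type) monoid_add
begin
definition zero_list :: "'a list" where "0 = []"
definition plus_list :: "'a list \<Rightarrow> 'a list \<Rightarrow> 'a list" where "xs + ys = xs @ ys"
instance by standard (simp_all add: zero_list_def plus_list_def)
end

type_synonym ('g, 'k) falg = "'g list \<Rightarrow>\<^sub>0 'k"

definition gen :: "'g \<Rightarrow> ('g, 'k::zero_neq_one) falg" where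
  "gen g = Poly_Mapping.single [g] 1"

definition scal :: "'k::zero \<Rightarrow> ('g, 'k) falg" where
  "scal k = Poly_Mapping.single [] k"

definition lin_ext :: "('k::zero \<Rightarrow> 'v \<Rightarrow> 'v) \<Rightarrow> ('a \<Rightarrow> 'v) \<Rightarrow> ('a \<Rightarrow>\<^sub>0 'k) \<Rightarrow> 'v::comm_monoid_add" where
  "lin_ext sc f v = (\<Sum>n\<in>Poly_Mapping.keys v. sc (Poly_Mapping.lookup v n) (f n))"

section \<open>The phase model\<close>

text \<open>
  Occupation numbers \<open>(n\<^sub>0, \<dots>, n\<^sub>M)\<close> are functions on \<^typ>\<open>nat\<close> that vanish above \<open>M\<close>. Both the space of
  kets and the space of bras consist of the finite linear combinations of such functions; they
  differ in the side on which the operators act.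
\<close>

type_synonym occ = "nat \<Rightarrow> nat"
type_synonym 'k ket = "occ \<Rightarrow>\<^sub>0 'k"
type_synonym 'k bra = "occ \<Rightarrow>\<^sub>0 'k"

definition ket_space :: "nat \<Rightarrow> 'k::zero ket set" where
  "ket_space M = {v. \<forall>n\<in>Poly_Mapping.keys v. \<forall>i>M. n i = 0}"

definition bra_space :: "nat \<Rightarrow> 'k::zero bra set" where
  "bra_space M = {v. \<forall>n\<in>Poly_Mapping.keys v. \<forall>i>M. n i = 0}"

definition phase_scale :: "'k::semiring_1 \<Rightarrow> (occ \<Rightarrow>\<^sub>0 'k) \<Rightarrow> (occ \<Rightarrow>\<^sub>0 'k)" where
  "phase_scale k v = Poly_Mapping.map ((*) k) v"

definition raise_occ :: "nat \<Rightarrow> (occ \<Rightarrow>\<^sub>0 'k) \<Rightarrow> (occ \<Rightarrow>\<^sub>0 'k::semiring_1)" where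
  "raise_occ i = lin_ext phase_scale (\<lambda>n. Poly_Mapping.single (n(i := n i + 1)) 1)"

definition lower_occ :: "nat \<Rightarrow> (occ \<Rightarrow>\<^sub>0 'k) \<Rightarrow> (occ \<Rightarrow>\<^sub>0 'k::semiring_1)" where
  "lower_occ i = lin_ext phase_scale
     (\<lambda>n. if n i = 0 then 0 else Poly_Mapping.single (n(i := n i - 1)) 1)"

datatype phase_gen = Psi nat | Psi_dag nat

fun ket_gen :: "phase_gen \<Rightarrow> 'k ket \<Rightarrow> 'k::semiring_1 ket" where
  "ket_gen (Psi i) = lower_occ i"
| "ket_gen (Psi_dag i) = raise_occ i"

fun bra_gen :: "phase_gen \<Rightarrow> 'k bra \<Rightarrow> 'k::semiring_1 bra" where
  "bra_gen (Psi i) = raise_occ i"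
| "bra_gen (Psi_dag i) = lower_occ i"

text \<open>In the left action the last letter of a word acts first, in the right action the first one.\<close>

definition ket_act :: "(phase_gen, 'k) falg \<Rightarrow> 'k ket \<Rightarrow> 'k::semiring_1 ket" where
  "ket_act a v = lin_ext phase_scale (\<lambda>w. foldr ket_gen w v) a"

definition bra_act :: "'k bra \<Rightarrow> (phase_gen, 'k) falg \<Rightarrow> 'k::semiring_1 bra" where
  "bra_act v a = lin_ext phase_scale (\<lambda>w. fold bra_gen w v) a"

text \<open>
  From here on \<open>s\<close> stands for \<open>x^(1/2)\<close>, so that \<open>x^(-1/2)\<close> is \<^term>\<open>inverse s\<close> and passing from \<open>x\<close> to \<open>1/x\<close>
  replaces \<open>s\<close> by \<^term>\<open>inverse s\<close>.
\<close>

definition lax :: "nat \<Rightarrow> 'k::field \<Rightarrow> ((phase_gen, 'k) falg)^2^2" where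
  "lax m s = vector [vector [scal (inverse s), gen (Psi_dag m)],
                     vector [gen (Psi m),      scal s]]"

fun monodromy :: "nat \<Rightarrow> 'k::field \<Rightarrow> ((phase_gen, 'k) falg)^2^2" where
  "monodromy 0 s = lax 0 s"
| "monodromy (Suc m) s = lax (Suc m) s ** monodromy m s"

definition phase_B :: "nat \<Rightarrow> 'k::field \<Rightarrow> 'k ket \<Rightarrow> 'k ket" where
  "phase_B M s v = ket_act (scal (s ^ M) * monodromy M s $ 1 $ 2) v"

definition phase_C :: "nat \<Rightarrow> 'k::field \<Rightarrow> 'k bra \<Rightarrow> 'k bra" where
  "phase_C M s v = bra_act v (scal (s ^ M) * monodromy M (inverse s) $ 2 $ 1)"

section \<open>Fermions\<close>

datatype fermi_gen = Fb int | Fc int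

type_synonym 'k falg_bc = "(fermi_gen, 'k) falg"

definition b_op :: "int \<Rightarrow> 'k::zero_neq_one falg_bc" where "b_op i = gen (Fb i)"
definition c_op :: "int \<Rightarrow> 'k::zero_neq_one falg_bc" where "c_op i = gen (Fc i)"

definition anticomm :: "'r::ring \<Rightarrow> 'r \<Rightarrow> 'r" where
  "anticomm X Y = X * Y + Y * X"

definition clifford_rels :: "'k::field_char_0 falg_bc set" where
  "clifford_rels =
     {anticomm (b_op i) (c_op j) - (if i = - j then 1 else 0) | i j. True} \<union>
     {anticomm (b_op i) (b_op j) | i j. True} \<union>
     {anticomm (c_op i) (c_op j) | i j. True}"

definition vac_annihilators :: "'k::field_char_0 falg_bc set" where
  "vac_annihilators = {b_op (m + 1) | m. m \<ge> 0} \<union> {c_op m | m. m \<ge> 0}"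

definition dual_vac_annihilators :: "'k::field_char_0 falg_bc set" where
  "dual_vac_annihilators = {b_op (i + 1) | i. i < 0} \<union> {c_op i | i. i < 0}"

text \<open>
  The Fock space is the left module over the Clifford algebra generated by one vector \<open>|0\<rangle>\<close> subject to
  the vacuum relations, that is, the quotient of the free algebra by the following left ideal; the
  dual Fock space is the analogous right module.
\<close>

inductive_set fock_ideal :: "'k::field_char_0 falg_bc set" where
  zero: "0 \<in> fock_ideal"
| add: "u \<in> fock_ideal \<Longrightarrow> v \<in> fock_ideal \<Longrightarrow> u + v \<in> fock_ideal"
| cliff: "r \<in> clifford_rels \<Longrightarrow> u * r * w \<in> fock_ideal"
| vac: "k \<in> vac_annihilators \<Longrightarrow> u * k \<in> fock_ideal"

inductive_set dual_fock_ideal :: "'k::field_char_0 falg_bc set" where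
  zero: "0 \<in> dual_fock_ideal"
| add: "u \<in> dual_fock_ideal \<Longrightarrow> v \<in> dual_fock_ideal \<Longrightarrow> u + v \<in> dual_fock_ideal"
| cliff: "r \<in> clifford_rels \<Longrightarrow> u * r * w \<in> dual_fock_ideal"
| vac: "k \<in> dual_vac_annihilators \<Longrightarrow> k * w \<in> dual_fock_ideal"

lemma fock_ideal_mult: "u \<in> fock_ideal \<Longrightarrow> a * u \<in> fock_ideal"
proof (induction rule: fock_ideal.induct)
  case (cliff r u w)
  then show ?case using fock_ideal.cliff[of r "a * u" w] by (simp add: mult.assoc)
next
  case (vac k u)
  then show ?case using fock_ideal.vac[of k "a * u"] by (simp add: mult.assoc)
qed (simp_all add: fock_ideal.zero fock_ideal.add distrib_left)

lemma dual_fock_ideal_mult: "u \<in> dual_fock_ideal \<Longrightarrow> u * a \<in> dual_fock_ideal"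
proof (induction rule: dual_fock_ideal.induct)
  case (cliff r u w)
  then show ?case using dual_fock_ideal.cliff[of r u "w * a"] by (simp add: mult.assoc)
next
  case (vac k w)
  then show ?case using dual_fock_ideal.vac[of k "w * a"] by (simp add: mult.assoc)
qed (simp_all add: dual_fock_ideal.zero dual_fock_ideal.add distrib_right)

lemma fock_ideal_uminus: "u \<in> fock_ideal \<Longrightarrow> - u \<in> fock_ideal"
  using fock_ideal_mult[of u "- 1"] by simp

lemma dual_fock_ideal_uminus: "u \<in> dual_fock_ideal \<Longrightarrow> - u \<in> dual_fock_ideal"
  using dual_fock_ideal_mult[of u "- 1"] by simp

lemma fock_ideal_diff: "u \<in> fock_ideal \<Longrightarrow> v \<in> fock_ideal \<Longrightarrow> u - v \<in> fock_ideal"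
  using fock_ideal.add[of u "- v"] fock_ideal_uminus[of v] by simp

definition fock_rel :: "'k::field_char_0 falg_bc \<Rightarrow> 'k falg_bc \<Rightarrow> bool" where
  "fock_rel u v \<longleftrightarrow> u - v \<in> fock_ideal"

lemma dual_fock_ideal_diff: "u \<in> dual_fock_ideal \<Longrightarrow> v \<in> dual_fock_ideal \<Longrightarrow> u - v \<in> dual_fock_ideal"
  using dual_fock_ideal.add[of u "- v"] dual_fock_ideal_uminus[of v] by simp

definition dual_fock_rel :: "'k::field_char_0 falg_bc \<Rightarrow> 'k falg_bc \<Rightarrow> bool" where
  "dual_fock_rel u v \<longleftrightarrow> u - v \<in> dual_fock_ideal"

lemma equivp_fock_rel: "equivp fock_rel"
proof (rule equivpI)
  show "reflp fock_rel" by (simp add: reflp_def fock_rel_def fock_ideal.zero)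
  show "symp fock_rel"
    using fock_ideal_uminus by (force simp: symp_def fock_rel_def)
  show "transp fock_rel"
    using fock_ideal.add by (force simp: transp_def fock_rel_def)
qed

lemma equivp_dual_fock_rel: "equivp dual_fock_rel"
proof (rule equivpI)
  show "reflp dual_fock_rel" by (simp add: reflp_def dual_fock_rel_def dual_fock_ideal.zero)
  show "symp dual_fock_rel"
    using dual_fock_ideal_uminus by (force simp: symp_def dual_fock_rel_def)
  show "transp dual_fock_rel"
    using dual_fock_ideal.add by (force simp: transp_def dual_fock_rel_def)
qed

text \<open>Otherwise lifting to the quotients would also unfold finitely supported functions.\<close>
lifting_forget poly_mapping.lifting

quotient_type (overloaded) 'k fock = "'k::field_char_0 falg_bc" / fock_rel
  by (rule equivp_fock_rel)

quotient_type (overloaded) 'k dual_fock = "'k::field_char_0 falg_bc" / dual_fock_rel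
  by (rule equivp_dual_fock_rel)

lemma diff_add_regroup: "(u + v) - (u' + v') = (u - u') + (v - v')" for u :: "'a::ab_group_add"
  by simp

lemma diff_diff_regroup: "(u - v) - (u' - v') = (u - u') - (v - v')" for u :: "'a::ab_group_add"
  by simp

lemma diff_uminus_regroup: "(- u) - (- v) = - (u - v)" for u :: "'a::ab_group_add"
  by simp

instantiation fock :: (field_char_0) ab_group_add
begin
lift_definition zero_fock :: "'a fock" is 0 .
lift_definition plus_fock :: "'a fock \<Rightarrow> 'a fock \<Rightarrow> 'a fock" is "(+)"
  unfolding fock_rel_def diff_add_regroup by (rule fock_ideal.add)
lift_definition uminus_fock :: "'a::field_char_0 fock \<Rightarrow> 'a fock" is uminus
  unfolding fock_rel_def diff_uminus_regroup by (rule fock_ideal_uminus)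
lift_definition minus_fock :: "'a fock \<Rightarrow> 'a fock \<Rightarrow> 'a fock" is "(-)"
  unfolding fock_rel_def diff_diff_regroup by (rule fock_ideal_diff)
instance
  by standard (transfer; simp add: fock_rel_def fock_ideal.zero)+
end

instantiation dual_fock :: (field_char_0) ab_group_add
begin
lift_definition zero_dual_fock :: "'a dual_fock" is 0 .
lift_definition plus_dual_fock :: "'a dual_fock \<Rightarrow> 'a dual_fock \<Rightarrow> 'a dual_fock" is "(+)"
  unfolding dual_fock_rel_def diff_add_regroup by (rule dual_fock_ideal.add)
lift_definition uminus_dual_fock :: "'a::field_char_0 dual_fock \<Rightarrow> 'a dual_fock" is uminus
  unfolding dual_fock_rel_def diff_uminus_regroup by (rule dual_fock_ideal_uminus)
lift_definition minus_dual_fock :: "'a dual_fock \<Rightarrow> 'a dual_fock \<Rightarrow> 'a dual_fock" is "(-)"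
  unfolding dual_fock_rel_def diff_diff_regroup by (rule dual_fock_ideal_diff)
instance
  by standard (transfer; simp add: dual_fock_rel_def dual_fock_ideal.zero)+
end

lift_definition vac :: "'k::field_char_0 fock" is 1 .
lift_definition dual_vac :: "'k::field_char_0 dual_fock" is 1 .

lift_definition fock_act :: "'k::field_char_0 falg_bc \<Rightarrow> 'k fock \<Rightarrow> 'k fock" is "(*)"
  unfolding fock_rel_def right_diff_distrib[symmetric] by (rule fock_ideal_mult)

lift_definition dual_fock_act :: "'k::field_char_0 dual_fock \<Rightarrow> 'k falg_bc \<Rightarrow> 'k dual_fock" is "(*)"
  unfolding dual_fock_rel_def left_diff_distrib[symmetric] by (rule dual_fock_ideal_mult)

definition fock_scale :: "'k::field_char_0 \<Rightarrow> 'k fock \<Rightarrow> 'k fock" where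
  "fock_scale k v = fock_act (scal k) v"

definition dual_fock_scale :: "'k::field_char_0 \<Rightarrow> 'k dual_fock \<Rightarrow> 'k dual_fock" where
  "dual_fock_scale k v = dual_fock_act v (scal k)"

definition balanced :: "'k::zero falg_bc \<Rightarrow> bool" where
  "balanced a \<longleftrightarrow> (\<forall>w\<in>Poly_Mapping.keys a.
     length (filter (\<lambda>g. \<exists>i. g = Fb i) w) = length (filter (\<lambda>g. \<exists>i. g = Fc i) w))"

definition fock0 :: "'k::field_char_0 fock set" where
  "fock0 = {fock_act a vac | a. balanced a}"

definition dual_fock0 :: "'k::field_char_0 dual_fock set" where
  "dual_fock0 = {dual_fock_act dual_vac a | a. balanced a}"

text \<open>
  The exponential of an algebra element that is locally nilpotent on the module; \<^const>\<open>Sum_any\<close> sums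
  the finitely many nonzero terms.
\<close>

definition fock_exp :: "'k::field_char_0 falg_bc \<Rightarrow> 'k fock \<Rightarrow> 'k fock" where
  "fock_exp a v = Sum_any (\<lambda>k. fock_scale (1 / fact k) (fock_act (a ^ k) v))"

definition dual_fock_exp :: "'k::field_char_0 falg_bc \<Rightarrow> 'k dual_fock \<Rightarrow> 'k dual_fock" where
  "dual_fock_exp a v = Sum_any (\<lambda>k. dual_fock_scale (1 / fact k) (dual_fock_act v (a ^ k)))"

text \<open>
  The infinite products are evaluated on a fixed vector as the eventually constant value of the
  finite products over \<open>M \<ge> i > M - N\<close>. In both of them the factor with \<open>i = M\<close> acts last: it is the
  leftmost factor of a left action, respectively the rightmost factor of a right action.
\<close>

definition eventual_value :: "(nat \<Rightarrow> 'a) \<Rightarrow> 'a" where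
  "eventual_value f = (THE y. \<forall>\<^sub>F N in sequentially. f N = y)"

definition factor_B :: "'k::field_char_0 \<Rightarrow> int \<Rightarrow> 'k fock \<Rightarrow> 'k fock" where
  "factor_B x i = fock_exp (scal x * (b_op (- (i - 1)) * c_op (i - 2)))"

definition factor_C :: "'k::field_char_0 \<Rightarrow> int \<Rightarrow> 'k dual_fock \<Rightarrow> 'k dual_fock" where
  "factor_C x i = dual_fock_exp (scal x * (b_op (- i + 2) * c_op (i - 1)))"

definition fermi_B :: "nat \<Rightarrow> 'k::field_char_0 \<Rightarrow> 'k fock \<Rightarrow> 'k fock" where
  "fermi_B M x v = eventual_value (\<lambda>N. foldr (\<lambda>k. factor_B x (int M - int k)) [0..<N] v)"

definition fermi_C :: "nat \<Rightarrow> 'k::field_char_0 \<Rightarrow> 'k dual_fock \<Rightarrow> 'k dual_fock" where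
  "fermi_C M x v = eventual_value (\<lambda>N. foldr (\<lambda>k. factor_C x (int M - int k)) [0..<N] v)"

section \<open>Partition states and the boson-fermion maps\<close>

text \<open>A partition is the weakly decreasing list of its positive parts, \<open>m\<^sub>i = \<mu>\<^sub>i - i\<close> for \<open>i = 1, \<dots>, l\<close>.\<close>

definition shifted_part :: "nat list \<Rightarrow> nat \<Rightarrow> int" where
  "shifted_part \<mu> i = int (\<mu> ! (i - 1)) - int i"

definition part_ket :: "nat list \<Rightarrow> 'k::field_char_0 fock" where
  "part_ket \<mu> = fock_act
     (prod_list (map (\<lambda>i. b_op (- shifted_part \<mu> i)) [1..<length \<mu> + 1]) *
      prod_list (map (\<lambda>j. c_op (- int j)) (rev [1..<length \<mu> + 1]))) vac"

definition part_bra :: "nat list \<Rightarrow> 'k::field_char_0 dual_fock" where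
  "part_bra \<mu> = dual_fock_act dual_vac
     (prod_list (map (\<lambda>j. b_op (int j)) [1..<length \<mu> + 1]) *
      prod_list (map (\<lambda>i. c_op (shifted_part \<mu> i)) (rev [1..<length \<mu> + 1])))"

definition occ_partition :: "nat \<Rightarrow> occ \<Rightarrow> nat list" where
  "occ_partition M n = concat (map (\<lambda>i. replicate (n i) i) (rev [1..<M + 1]))"

definition Mbc :: "nat \<Rightarrow> 'k::field_char_0 ket \<Rightarrow> 'k fock" where
  "Mbc M = lin_ext fock_scale (\<lambda>n. part_ket (occ_partition M n))"

definition Mbc_dual :: "nat \<Rightarrow> 'k::field_char_0 bra \<Rightarrow> 'k dual_fock" where
  "Mbc_dual M = lin_ext dual_fock_scale (\<lambda>n. part_bra (occ_partition M n))"

end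

theory Submission
  imports Defs
begin

text \<open>
  Both operators add horizontal strips: applied to the state of a partition \<open>\<nu>\<close> with parts at most \<open>M\<close>, each
  yields the sum of the states of all partitions \<open>\<lambda>\<close> with parts at most \<open>M\<close> such that \<open>\<lambda> / \<nu>\<close> has at most one box
  in every column, with the weight \<open>x\<close> to the number of boxes. The two sides produce this sum in different
  ways, by columns and by rows, and the proof matches the recursions instead of the sums.

  On the phase side, \<open>T\<^sub>M = L\<^sub>M T\<^sub>M\<^sub>-\<^sub>1\<close> gives a recursion in \<open>M\<close> for \<open>strip = x^(M/2) B\<close> and
  \<open>open_strip = x^((M+1)/2) D\<close> (\<open>monodromy_ket_act\<close>), whose increment puts a new part of size \<open>M\<close> on top.

  On the fermionic side a factor is \<open>1 + x b(1 - i) c(i - 2)\<close>: it moves a particle from position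
  \<open>i - 2\<close> to \<open>i - 1\<close> if that is free, and the lower factors act first. A particle therefore hops upwards any
  number of steps, but not past the original position of the next higher one, which has not moved yet. This
  is the interlacing condition of a horizontal strip, and no two terms cancel. Splitting off the highest
  particle, that is the first row of \<open>\<nu>\<close>, gives \<open>fermi_prod_top\<close> and \<open>fermi_prod_row\<close>: the increment in the top
  index is the term in which this particle has reached the top. The two increments agree, which is
  \<open>row_map_strip\<close>, proved by induction on \<open>M\<close> and on the number of parts equal to \<open>M\<close>.

  The dual statement needs no second computation. On bras, \<open>x^(M/2) C(1/x)\<close> is the same operator on occupation
  numbers as \<open>x^(M/2) B(x)\<close> on kets (\<open>monodromy_bra_act\<close>), and the anti-involution \<open>b(i) \<leftrightarrow> c(-i)\<close> of the
  Clifford algebra induces a map from the Fock space onto its dual that carries the partition states, the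
  factors and the charge zero subspace to their dual counterparts (\<open>part_bra_mirror\<close>, \<open>factor_C_mirror\<close>,
  \<open>dual_fock0_eq\<close>).
\<close>

section \<open>Linear maps on finitely supported functions\<close>

text \<open>
  Linearity is expressed by \<^const>\<open>module_hom\<close>; this scaling serves both the kets and the free
  algebras, where it agrees with multiplication by a scalar.
\<close>

abbreviation pscale :: "'k::comm_ring_1 \<Rightarrow> ('a \<Rightarrow>\<^sub>0 'k) \<Rightarrow> ('a \<Rightarrow>\<^sub>0 'k)" where
  "pscale \<equiv> \<lambda>k. Poly_Mapping.map ((*) k)"

lemma lookup_pscale: "Poly_Mapping.lookup (pscale k v) n = k * Poly_Mapping.lookup v n"
  by (simp add: Poly_Mapping.map.rep_eq when_def)

lemma module_pscale: "module (pscale :: 'k::comm_ring_1 \<Rightarrow> _)"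
  by (standard; rule poly_mapping_eqI; simp add: lookup_pscale lookup_add algebra_simps)

lemma pscale_scal: "pscale k a = scal k * a" for a :: "('g, 'k::comm_ring_1) falg"
  by (simp add: mult_map_scale_conv_mult scal_def zero_list_def)

lemma phase_scale_eq: "phase_scale = pscale"
  by (simp add: phase_scale_def fun_eq_iff)

lemma module_phase_scale: "module (phase_scale :: 'k::field \<Rightarrow> _)"
  unfolding phase_scale_eq by (rule module_pscale)

lemma keys_pscale: "Poly_Mapping.keys (pscale k v) \<subseteq> Poly_Mapping.keys v"
  by (auto simp: in_keys_iff lookup_pscale)

lemma lin_ext_superset:
  fixes sc :: "'k::comm_ring_1 \<Rightarrow> 'v::ab_group_add \<Rightarrow> 'v"
  assumes "module sc" "finite A" "Poly_Mapping.keys v \<subseteq> A"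
  shows "lin_ext sc f v = (\<Sum>n\<in>A. sc (Poly_Mapping.lookup v n) (f n))"
  unfolding lin_ext_def using assms
  by (intro sum.mono_neutral_left) (auto simp: in_keys_iff module.scale_zero_left)

lemma lin_ext_hom:
  fixes sc :: "'k::comm_ring_1 \<Rightarrow> 'v::ab_group_add \<Rightarrow> 'v"
  assumes "module sc"
  shows "module_hom pscale sc (lin_ext sc f)"
  unfolding module_hom_iff
proof (intro conjI allI)
  fix u v :: "'a \<Rightarrow>\<^sub>0 'k"
  let ?A = "Poly_Mapping.keys u \<union> Poly_Mapping.keys v"
  have "lin_ext sc f w = (\<Sum>n\<in>?A. sc (Poly_Mapping.lookup w n) (f n))" if "w \<in> {u, v, u + v}" for w
    using that keys_add[of u v] by (intro lin_ext_superset[OF assms]) auto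
  then show "lin_ext sc f (u + v) = lin_ext sc f u + lin_ext sc f v"
    by (simp add: lookup_add module.scale_left_distrib[OF assms] sum.distrib)
next
  fix k and v :: "'a \<Rightarrow>\<^sub>0 'k"
  have "lin_ext sc f (pscale k v)
      = (\<Sum>n\<in>Poly_Mapping.keys v. sc (Poly_Mapping.lookup (pscale k v) n) (f n))"
    by (intro lin_ext_superset[OF assms] keys_pscale) simp
  then show "lin_ext sc f (pscale k v) = sc k (lin_ext sc f v)"
    by (simp add: lin_ext_def lookup_pscale module.scale_sum_right[OF assms] module.scale_scale[OF assms])
qed (use assms module_pscale in auto)

lemma lin_ext_single:
  assumes "module sc"
  shows "lin_ext sc f (Poly_Mapping.single n k) = sc k (f n)"
  using lin_ext_superset[OF assms, of "{n}" "Poly_Mapping.single n k" f] by simp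

lemma sum_pscale_single:
  "v = (\<Sum>n\<in>Poly_Mapping.keys v. pscale (Poly_Mapping.lookup v n) (Poly_Mapping.single n 1))"
proof (rule poly_mapping_eqI)
  fix m
  have "Poly_Mapping.lookup v m
      = (\<Sum>n\<in>Poly_Mapping.keys v. if n = m then Poly_Mapping.lookup v n else 0)"
    by (simp add: in_keys_iff)
  also have "\<dots> = (\<Sum>n\<in>Poly_Mapping.keys v. Poly_Mapping.lookup v n * Poly_Mapping.lookup (Poly_Mapping.single n 1) m)"
    by (intro sum.cong) (auto simp: lookup_single when_def)
  finally show "Poly_Mapping.lookup v m = Poly_Mapping.lookup
     (\<Sum>n\<in>Poly_Mapping.keys v. pscale (Poly_Mapping.lookup v n) (Poly_Mapping.single n 1)) m"
    by (simp only: lookup_sum lookup_pscale)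
qed

text \<open>
  Only the basis vectors in the support matter, so that maps that agree merely on a span of occupation
  numbers (as in \<open>Mbc_strip\<close>) can be compared at a vector of that span.
\<close>

lemma hom_eqI:
  assumes f: "module_hom pscale sc f" and g: "module_hom pscale sc g"
    and eq: "\<And>n. n \<in> Poly_Mapping.keys v \<Longrightarrow> f (Poly_Mapping.single n 1) = g (Poly_Mapping.single n 1)"
  shows "f v = g v"
proof -
  have "h v = (\<Sum>n\<in>Poly_Mapping.keys v. sc (Poly_Mapping.lookup v n) (h (Poly_Mapping.single n 1)))"
    if "module_hom pscale sc h" for h
    by (subst sum_pscale_single) (simp only: module_hom.sum[OF that] module_hom.scale[OF that])
  from this[OF f] this[OF g] show ?thesis by (simp add: eq)
qed

lemma falg_induct [case_names scal gen add]:
  fixes a :: "('g, 'k::comm_ring_1) falg"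
  assumes scal: "\<And>k. P (scal k)" and gen: "\<And>g a. P a \<Longrightarrow> P (gen g * a)"
    and add: "\<And>a b. P a \<Longrightarrow> P b \<Longrightarrow> P (a + b)"
  shows "P a"
proof -
  have single: "P (Poly_Mapping.single w k)" for w k
  proof (induction w)
    case (Cons g w)
    from gen[OF this, of g] show ?case by (simp add: gen_def mult_single plus_list_def)
  qed (use scal in \<open>simp add: scal_def\<close>)
  have "P (\<Sum>w\<in>A. pscale (Poly_Mapping.lookup a w) (Poly_Mapping.single w 1))" if "finite A" for A
    using that
  proof induction
    case empty
    show ?case using scal[of 0] by (simp add: scal_def)
  next
    case (insert w A)
    then show ?case using single by (simp add: add)
  qed
  then show ?thesis using sum_pscale_single[of a] by (metis finite_keys)
qed

lemma scal_add: "scal (k + l) = scal k + scal l" for k l :: "'k::comm_ring_1"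
  by (simp add: scal_def single_add)

lemma scal_mult: "scal (k * l) = scal k * scal l" for k l :: "'k::comm_ring_1"
  by (simp add: scal_def mult_single plus_list_def)

lemma scal_1: "scal (1::'k::comm_ring_1) = 1"
  by (simp add: scal_def flip: zero_list_def)

lemma scal_central: "scal k * a = a * scal k" for a :: "('g, 'k::comm_ring_1) falg"
proof (induction a rule: falg_induct)
  case (scal l)
  show ?case by (simp flip: scal_mult add: mult.commute)
next
  case (gen g a)
  have "scal k * gen g = gen g * scal k"
    by (simp add: scal_def gen_def mult_single plus_list_def)
  then show ?case using gen by (metis mult.assoc)
qed (simp add: algebra_simps)

lemma gen_mult_hom: "module_hom pscale pscale ((*) a)" for a :: "('g, 'k::comm_ring_1) falg"
proof -
  have "a * pscale k b = pscale k (a * b)" for k b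
    unfolding pscale_scal by (metis mult.assoc scal_central)
  then show ?thesis
    by (simp add: module_hom_iff module_pscale distrib_left)
qed

section \<open>The phase model: the monodromy entry as a strip operator\<close>

lemmas phase_scale_simps = module.scale_right_distrib[OF module_phase_scale]
  module.scale_scale[OF module_phase_scale] module.scale_one[OF module_phase_scale]

lemma lin_ext_phase_hom: "module_hom pscale phase_scale (lin_ext phase_scale f)"
  for f :: "_ \<Rightarrow> 'k::field ket"
  by (rule lin_ext_hom[OF module_phase_scale])

lemma raise_hom: "module_hom phase_scale phase_scale (raise_occ i :: 'k::field ket \<Rightarrow> _)"
  and lower_hom: "module_hom phase_scale phase_scale (lower_occ i :: 'k ket \<Rightarrow> _)"
  using lin_ext_phase_hom by (simp_all add: raise_occ_def lower_occ_def phase_scale_eq)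

lemma raise_single: "raise_occ i (Poly_Mapping.single n (1::'k::field)) = Poly_Mapping.single (n(i := n i + 1)) 1"
  and lower_single: "lower_occ i (Poly_Mapping.single n (1::'k))
    = (if n i = 0 then 0 else Poly_Mapping.single (n(i := n i - 1)) 1)"
  by (auto simp: raise_occ_def lower_occ_def lin_ext_single module_phase_scale
      module.scale_one[OF module_phase_scale])

lemma phase_hom_eqI:
  assumes "module_hom phase_scale sc f" "module_hom phase_scale sc g"
    and "\<And>n. n \<in> Poly_Mapping.keys v \<Longrightarrow> f (Poly_Mapping.single n 1) = g (Poly_Mapping.single n 1)"
  shows "f v = g v"
  using hom_eqI[of sc f g v] assms by (simp add: phase_scale_eq)

lemma phase_hom_comp_eqI:
  assumes "module_hom phase_scale phase_scale f" "module_hom phase_scale phase_scale g"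
    and "module_hom phase_scale phase_scale f'" "module_hom phase_scale phase_scale g'"
    and "\<And>n. f (g (Poly_Mapping.single n 1)) = f' (g' (Poly_Mapping.single n 1))"
  shows "f (g v) = f' (g' v)"
  using phase_hom_eqI[OF module_hom_compose[OF assms(2,1)] module_hom_compose[OF assms(4,3)], of v] assms(5)
  by simp

lemma raise_raise: "raise_occ i (raise_occ j v) = raise_occ j (raise_occ i v)"
  for v :: "'k::field ket"
  by (rule phase_hom_comp_eqI[OF raise_hom raise_hom raise_hom raise_hom])
     (auto simp: raise_single fun_upd_twist)

lemma lower_lower: "lower_occ i (lower_occ j v) = lower_occ j (lower_occ i v)"
  for v :: "'k::field ket"
  by (rule phase_hom_comp_eqI[OF lower_hom lower_hom lower_hom lower_hom])
     (auto simp: lower_single module_hom.zero[OF lower_hom] fun_upd_twist)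

lemma lower_raise: "i \<noteq> j \<Longrightarrow> lower_occ i (raise_occ j v) = raise_occ j (lower_occ i v)"
  for v :: "'k::field ket"
  by (rule phase_hom_comp_eqI[OF lower_hom raise_hom raise_hom lower_hom])
     (auto simp: lower_single raise_single module_hom.zero[OF raise_hom] fun_upd_twist)

lemma lower_raise_same: "lower_occ i (raise_occ i v) = v"
  for v :: "'k::field ket"
  using phase_hom_comp_eqI[OF lower_hom raise_hom module.module_hom_ident module.module_hom_ident,
      OF module_phase_scale module_phase_scale, of i i v]
  by (simp add: lower_single raise_single)

text \<open>
  Rescaled by powers of \<open>s\<close>, the first-order recursion of the two relevant monodromy entries involves only
  \<open>x = s\<^sup>2\<close>. Read from site \<open>0\<close> upwards, a horizontal strip is a choice of columns that receive a box:
  \<open>strip\<close> sums the configurations in which the column beyond \<open>m\<close> receives none, \<open>open_strip\<close> those in which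
  column \<open>m + 1\<close> receives one, a part of size \<open>m + 1\<close> being still in transit. The weight counts the boxes.
\<close>

fun strip :: "'k::field \<Rightarrow> nat \<Rightarrow> 'k ket \<Rightarrow> 'k ket"
  and open_strip :: "'k::field \<Rightarrow> nat \<Rightarrow> 'k ket \<Rightarrow> 'k ket" where
  "strip x 0 v = raise_occ 0 v"
| "strip x (Suc m) v = strip x m v + raise_occ (Suc m) (open_strip x m v)"
| "open_strip x 0 v = phase_scale x v"
| "open_strip x (Suc m) v = phase_scale x (lower_occ (Suc m) (strip x m v) + open_strip x m v)"

lemma strip_hom: "module_hom phase_scale phase_scale (strip x m)"
  "module_hom phase_scale phase_scale (open_strip x m)"
proof (induction m)
  case 0
  have "strip x 0 = raise_occ 0" "open_strip x 0 = phase_scale x" by (simp_all add: fun_eq_iff)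
  then show "module_hom phase_scale phase_scale (strip x 0)"
    "module_hom phase_scale phase_scale (open_strip x 0)"
    using raise_hom module.module_hom_scale_self[OF module_phase_scale] by simp_all
next
  case (Suc m)
  note add = module_hom.add[OF Suc.IH(1)] module_hom.add[OF Suc.IH(2)]
      module_hom.add[OF raise_hom] module_hom.add[OF lower_hom]
    and scale = module_hom.scale[OF Suc.IH(1)] module_hom.scale[OF Suc.IH(2)]
      module_hom.scale[OF raise_hom] module_hom.scale[OF lower_hom]
  show "module_hom phase_scale phase_scale (strip x (Suc m))"
    "module_hom phase_scale phase_scale (open_strip x (Suc m))"
    by (simp_all add: module_hom_iff module_phase_scale add scale phase_scale_simps mult.commute)
qed

text \<open>
  The operators up to site \<open>m\<close> do not touch the sites beyond it.
\<close>

lemma strip_raise_commute: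
  assumes "m < i"
  shows "strip x m (raise_occ i v) = raise_occ i (strip x m v)"
    "open_strip x m (raise_occ i v) = raise_occ i (open_strip x m v)"
  using assms
  by (induction m)
     (auto simp: raise_raise lower_raise module_hom.add[OF raise_hom] module_hom.scale[OF raise_hom]
      intro: raise_raise)

lemma strip_lower_commute:
  assumes "m < i"
  shows "strip x m (lower_occ i v) = lower_occ i (strip x m v)"
    "open_strip x m (lower_occ i v) = lower_occ i (open_strip x m v)"
  using assms
  by (induction m)
     (auto simp: lower_lower lower_raise module_hom.add[OF lower_hom] module_hom.scale[OF lower_hom]
      intro: lower_lower)

lemma ket_gen_hom: "module_hom phase_scale phase_scale (ket_gen g :: 'k::field ket \<Rightarrow> _)"
  by (cases g) (simp_all add: raise_hom lower_hom)

lemma ket_act_hom: "module_hom pscale phase_scale (\<lambda>a. ket_act a v)"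
  for v :: "'k::field ket"
  unfolding ket_act_def by (rule lin_ext_phase_hom)

lemma bra_act_hom: "module_hom pscale phase_scale (bra_act v)"
  for v :: "'k::field bra"
  using lin_ext_phase_hom[of "\<lambda>w. fold bra_gen w v"] by (simp add: bra_act_def[abs_def])

lemma ket_act_simps:
  fixes v :: "'k::field ket"
  shows "ket_act (a + b) v = ket_act a v + ket_act b v"
    and "ket_act (scal k) v = phase_scale k v"
    and "ket_act (scal k * a) v = phase_scale k (ket_act a v)"
    and "ket_act (gen g * a) v = ket_gen g (ket_act a v)"
    and "ket_act (gen g) v = ket_gen g v"
proof -
  show "ket_act (a + b) v = ket_act a v + ket_act b v"
    by (rule module_hom.add[OF ket_act_hom])
  show "ket_act (scal k) v = phase_scale k v"
    by (simp add: ket_act_def scal_def lin_ext_single module_phase_scale)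
  show "ket_act (scal k * a) v = phase_scale k (ket_act a v)"
    using module_hom.scale[OF ket_act_hom] by (simp add: pscale_scal)
  show "ket_act (gen g) v = ket_gen g v"
    by (simp add: ket_act_def gen_def lin_ext_single module_phase_scale module.scale_one[OF module_phase_scale])
  have "module_hom pscale phase_scale (\<lambda>a. ket_act (gen g * a) v)"
    using module_hom_compose[OF gen_mult_hom[of "gen g"] ket_act_hom[of v]] by (simp add: o_def)
  moreover have "module_hom pscale phase_scale (\<lambda>a. ket_gen g (ket_act a v))"
    using module_hom_compose[OF ket_act_hom ket_gen_hom] by (simp add: o_def)
  ultimately show "ket_act (gen g * a) v = ket_gen g (ket_act a v)"
    by (rule hom_eqI)
       (simp add: ket_act_def gen_def mult_single plus_list_def lin_ext_single module_phase_scale module.scale_one[OF module_phase_scale])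
qed

lemma bra_act_simps:
  fixes v :: "'k::field bra"
  shows "bra_act v (a + b) = bra_act v a + bra_act v b"
    and "bra_act v (scal k) = phase_scale k v"
    and "bra_act v (scal k * a) = phase_scale k (bra_act v a)"
    and "bra_act v (gen g * a) = bra_act (bra_gen g v) a"
    and "bra_act v (gen g) = bra_gen g v"
proof -
  show "bra_act v (a + b) = bra_act v a + bra_act v b"
    by (rule module_hom.add[OF bra_act_hom])
  show "bra_act v (scal k) = phase_scale k v"
    by (simp add: bra_act_def scal_def lin_ext_single module_phase_scale)
  show "bra_act v (scal k * a) = phase_scale k (bra_act v a)"
    using module_hom.scale[OF bra_act_hom] by (simp add: pscale_scal)
  show "bra_act v (gen g) = bra_gen g v"
    by (simp add: bra_act_def gen_def lin_ext_single module_phase_scale module.scale_one[OF module_phase_scale])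
  have "module_hom pscale phase_scale (\<lambda>a. bra_act v (gen g * a))"
    using module_hom_compose[OF gen_mult_hom[of "gen g"] bra_act_hom[of v]] by (simp add: o_def)
  then show "bra_act v (gen g * a) = bra_act (bra_gen g v) a"
    by (rule hom_eqI[OF _ bra_act_hom])
       (simp add: bra_act_def gen_def mult_single plus_list_def lin_ext_single module_phase_scale module.scale_one[OF module_phase_scale])
qed

lemma lax_entries:
  "lax m s $ 1 $ 1 = scal (inverse s)" "lax m s $ 1 $ 2 = gen (Psi_dag m)"
  "lax m s $ 2 $ 1 = gen (Psi m)" "lax m s $ 2 $ 2 = scal s"
  by (simp_all add: lax_def)

lemma monodromy_Suc:
  "monodromy (Suc m) s $ i $ j = lax (Suc m) s $ i $ 1 * monodromy m s $ 1 $ j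
     + lax (Suc m) s $ i $ 2 * monodromy m s $ 2 $ j"
  by (simp add: matrix_matrix_mult_def sum_2)

lemma monodromy_ket_act:
  fixes v :: "'k::field ket"
  assumes "s \<noteq> 0"
  shows "phase_scale (s ^ m) (ket_act (monodromy m s $ 1 $ 2) v) = strip (s\<^sup>2) m v"
    and "phase_scale (s ^ Suc m) (ket_act (monodromy m s $ 2 $ 2) v) = open_strip (s\<^sup>2) m v"
proof (induction m)
  case 0
  show "phase_scale (s ^ 0) (ket_act (monodromy 0 s $ 1 $ 2) v) = strip (s\<^sup>2) 0 v"
    "phase_scale (s ^ Suc 0) (ket_act (monodromy 0 s $ 2 $ 2) v) = open_strip (s\<^sup>2) 0 v"
    by (simp_all add: lax_entries ket_act_simps phase_scale_simps power2_eq_square)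
next
  case (Suc m)
  have eq: "s ^ Suc m * inverse s = s ^ m" "s ^ Suc (Suc m) * s = s\<^sup>2 * s ^ Suc m"
    "s ^ Suc (Suc m) = s\<^sup>2 * s ^ m"
    using assms by (simp_all add: power2_eq_square field_simps)
  show "phase_scale (s ^ Suc m) (ket_act (monodromy (Suc m) s $ 1 $ 2) v) = strip (s\<^sup>2) (Suc m) v"
    unfolding monodromy_Suc strip.simps Suc.IH[symmetric] lax_entries ket_act_simps ket_gen.simps
      phase_scale_simps eq module_hom.scale[OF raise_hom] ..
  show "phase_scale (s ^ Suc (Suc m)) (ket_act (monodromy (Suc m) s $ 2 $ 2) v) = open_strip (s\<^sup>2) (Suc m) v"
    unfolding monodromy_Suc open_strip.simps Suc.IH[symmetric] lax_entries ket_act_simps ket_gen.simps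
      phase_scale_simps eq(2) module_hom.scale[OF lower_hom]
    by (simp add: phase_scale_simps power2_eq_square mult.assoc flip: module_hom.scale[OF lower_hom])
qed

text \<open>
  Inverting \<open>s\<close> exchanges the roles of the two diagonal entries, and acting on bras exchanges raising and
  lowering, so the transposed entries obey the same recursion. In a right action the operator of the new
  site acts first instead of last, which is harmless as it commutes with the others.
\<close>

lemma monodromy_bra_act:
  fixes v :: "'k::field bra"
  assumes "s \<noteq> 0"
  shows "phase_scale (s ^ m) (bra_act v (monodromy m (inverse s) $ 2 $ 1)) = strip (s\<^sup>2) m v"
    and "phase_scale (s ^ Suc m) (bra_act v (monodromy m (inverse s) $ 1 $ 1)) = open_strip (s\<^sup>2) m v"
proof (induction m arbitrary: v)
  case 0
  show "phase_scale (s ^ 0) (bra_act v (monodromy 0 (inverse s) $ 2 $ 1)) = strip (s\<^sup>2) 0 v"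
    "phase_scale (s ^ Suc 0) (bra_act v (monodromy 0 (inverse s) $ 1 $ 1)) = open_strip (s\<^sup>2) 0 v"
    for v :: "'k::field bra"
    by (simp_all add: lax_entries bra_act_simps phase_scale_simps power2_eq_square)
next
  case (Suc m)
  have eq: "s ^ Suc m * inverse s = s ^ m" "s ^ Suc (Suc m) * s = s\<^sup>2 * s ^ Suc m"
    "s ^ Suc (Suc m) = s\<^sup>2 * s ^ m"
    using assms by (simp_all add: power2_eq_square field_simps)
  show "phase_scale (s ^ Suc m) (bra_act v (monodromy (Suc m) (inverse s) $ 2 $ 1)) = strip (s\<^sup>2) (Suc m) v"
    for v :: "'k::field bra"
    unfolding monodromy_Suc strip.simps lax_entries bra_act_simps bra_gen.simps
      phase_scale_simps eq Suc.IH strip_raise_commute[OF lessI] by (rule add.commute)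
  show "phase_scale (s ^ Suc (Suc m)) (bra_act v (monodromy (Suc m) (inverse s) $ 1 $ 1)) = open_strip (s\<^sup>2) (Suc m) v"
    for v :: "'k::field bra"
    unfolding monodromy_Suc open_strip.simps lax_entries bra_act_simps bra_gen.simps inverse_inverse_eq
      phase_scale_simps eq(2)
    by (simp add: eq(3) Suc.IH strip_lower_commute[OF lessI] flip: phase_scale_simps(2) power_Suc)
qed

lemma phase_B_eq_strip: "s \<noteq> 0 \<Longrightarrow> phase_B M s v = strip (s\<^sup>2) M v"
  by (simp add: phase_B_def ket_act_simps monodromy_ket_act)

lemma phase_C_eq_strip: "s \<noteq> 0 \<Longrightarrow> phase_C M s v = strip (s\<^sup>2) M v"
  by (simp add: phase_C_def bra_act_simps monodromy_bra_act)

lemma ket_space_closed: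
  fixes u v :: "'k::field ket"
  shows "u \<in> ket_space M \<Longrightarrow> v \<in> ket_space M \<Longrightarrow> u + v \<in> ket_space M"
    and "v \<in> ket_space M \<Longrightarrow> phase_scale k v \<in> ket_space M"
    and "v \<in> ket_space M \<Longrightarrow> i \<le> M \<Longrightarrow> raise_occ i v \<in> ket_space M"
    and "v \<in> ket_space M \<Longrightarrow> lower_occ i v \<in> ket_space M"
proof -
  show "u \<in> ket_space M \<Longrightarrow> v \<in> ket_space M \<Longrightarrow> u + v \<in> ket_space M"
    using keys_add[of u v] by (auto simp: ket_space_def)
  show *: "v \<in> ket_space M \<Longrightarrow> phase_scale k v \<in> ket_space M" for v :: "'k ket" and k
    using keys_pscale[of k v] by (auto simp: ket_space_def phase_scale_eq)
  have sum: "(\<Sum>n\<in>A. f n) \<in> ket_space M" if "\<And>n. n \<in> A \<Longrightarrow> f n \<in> ket_space M"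
    for A and f :: "occ \<Rightarrow> 'k ket"
    using that keys_sum[of f A] by (fastforce simp: ket_space_def)
  show "v \<in> ket_space M \<Longrightarrow> i \<le> M \<Longrightarrow> raise_occ i v \<in> ket_space M"
    unfolding raise_occ_def lin_ext_def by (intro sum *) (auto simp: ket_space_def)
  show "v \<in> ket_space M \<Longrightarrow> lower_occ i v \<in> ket_space M"
    unfolding lower_occ_def lin_ext_def by (intro sum *) (auto simp: ket_space_def)
qed

lemma strip_ket_space:
  assumes "v \<in> ket_space M" "m \<le> M"
  shows "strip x m v \<in> ket_space M" "open_strip x m v \<in> ket_space M"
  using assms by (induction m) (auto intro!: ket_space_closed)

section \<open>The fermionic product\<close>

lemma fock_act_add_left: "fock_act (a + b) v = fock_act a v + fock_act b v"
  by transfer (simp add: fock_rel_def fock_ideal.zero distrib_right)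

lemma fock_act_add: "fock_act a (u + v) = fock_act a u + fock_act a v"
  by transfer (simp add: fock_rel_def fock_ideal.zero distrib_left)

lemma fock_act_mult: "fock_act (a * b) v = fock_act a (fock_act b v)"
  by transfer (simp add: fock_rel_def fock_ideal.zero mult.assoc)

lemma fock_act_1: "fock_act 1 v = v"
  by transfer (simp add: fock_rel_def fock_ideal.zero)

lemma module_fock_scale: "module fock_scale"
  by standard (simp_all add: fock_scale_def fock_act_add fock_act_add_left fock_act_mult fock_act_1
      scal_add scal_mult scal_1)

lemma fock_act_scale: "fock_act a (fock_scale k v) = fock_scale k (fock_act a v)"
  by (metis fock_act_mult fock_scale_def scal_central)

lemma fock_act_hom: "module_hom fock_scale fock_scale (fock_act a)"
  by (simp add: module_hom_iff module_fock_scale fock_act_add fock_act_scale)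

lemmas fock_act_zero [simp] = module_hom.zero[OF fock_act_hom]
lemmas fock_act_uminus = module_hom.neg[OF fock_act_hom]
lemmas fock_act_minus = module_hom.diff[OF fock_act_hom]

lemmas fock_scale_simps = module.scale_right_distrib[OF module_fock_scale]
  module.scale_scale[OF module_fock_scale] module.scale_one[OF module_fock_scale]
  module.scale_minus_right[OF module_fock_scale] module.scale_right_diff_distrib[OF module_fock_scale]

lemma fock_scale_zero [simp]: "fock_scale k 0 = 0"
  by (rule module.scale_zero_right[OF module_fock_scale])

abbreviation fb :: "int \<Rightarrow> 'k::field_char_0 fock \<Rightarrow> 'k fock" where "fb i \<equiv> fock_act (b_op i)"
abbreviation fc :: "int \<Rightarrow> 'k::field_char_0 fock \<Rightarrow> 'k fock" where "fc i \<equiv> fock_act (c_op i)"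

lemma fock_act_clifford_rel: "r \<in> clifford_rels \<Longrightarrow> fock_act r v = 0"
proof transfer
  fix r v :: "'a falg_bc"
  assume "r \<in> clifford_rels"
  then show "fock_rel (r * v) 0"
    using fock_ideal.cliff[of r 1 v] by (simp add: fock_rel_def)
qed

lemma b_b_anticomm: "fb i (fb j v) = - fb j (fb i v)"
  using fock_act_clifford_rel[of "anticomm (b_op i) (b_op j)" v]
  by (auto simp: clifford_rels_def anticomm_def fock_act_add_left fock_act_mult eq_neg_iff_add_eq_0)

lemma c_c_anticomm: "fc i (fc j v) = - fc j (fc i v)"
  using fock_act_clifford_rel[of "anticomm (c_op i) (c_op j)" v]
  by (auto simp: clifford_rels_def anticomm_def fock_act_add_left fock_act_mult eq_neg_iff_add_eq_0)

lemma c_b_anticomm: "fc j (fb i v) = (if i = - j then v else 0) - fb i (fc j v)"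
proof -
  let ?d = "if i = - j then 1 else 0 :: 'a falg_bc"
  have "fock_act (anticomm (b_op i) (c_op j) - ?d) v = 0"
    by (rule fock_act_clifford_rel) (auto simp: clifford_rels_def)
  moreover have "fock_act (anticomm (b_op i) (c_op j)) v
      = fock_act (anticomm (b_op i) (c_op j) - ?d) v + fock_act ?d v"
    by (simp flip: fock_act_add_left)
  moreover have "fock_act 0 v = 0"
    using fock_act_add_left[of 0 0 v] by simp
  ultimately have "fock_act (anticomm (b_op i) (c_op j)) v = (if i = - j then v else 0)"
    by (simp add: fock_act_1 split: if_splits)
  then show ?thesis
    by (auto simp: anticomm_def fock_act_add_left fock_act_mult algebra_simps)
qed

text \<open>
  Needed for \<open>b(i)\<^sup>2 = 0\<close>: the relations only give \<open>2 b(i)\<^sup>2 = 0\<close>. Likewise for \<open>c(i)\<close>.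
\<close>

lemma eq_uminus_self: "v = - v \<Longrightarrow> v = (0 :: 'k::field_char_0 fock)"
proof -
  assume "v = - v"
  then have "fock_scale 2 v = 0"
    using module.scale_left_distrib[OF module_fock_scale, of 1 1 v] fock_scale_simps(3)[of v]
    by (metis one_add_one add.right_inverse)
  then have "fock_scale (1 / 2) (fock_scale 2 v) = 0" by simp
  then show ?thesis by (simp add: fock_scale_simps)
qed

lemma b_b_same [simp]: "fb i (fb i v) = 0"
  using eq_uminus_self[OF b_b_anticomm] .

lemma c_c_same [simp]: "fc i (fc i v) = 0"
  using eq_uminus_self[OF c_c_anticomm] .

lemma fock_act_vac_annihilator: "k \<in> vac_annihilators \<Longrightarrow> fock_act k vac = 0"
proof transfer
  fix k :: "'a falg_bc"
  assume "k \<in> vac_annihilators"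
  then show "fock_rel (k * 1) 0"
    using fock_ideal.vac[of k 1] by (simp add: fock_rel_def)
qed

lemma b_vac: "i > 0 \<Longrightarrow> fb i vac = 0"
  by (rule fock_act_vac_annihilator) (auto simp: vac_annihilators_def intro!: exI[of _ "i - 1"])

lemma c_vac: "i \<ge> 0 \<Longrightarrow> fc i vac = 0"
  by (rule fock_act_vac_annihilator) (auto simp: vac_annihilators_def)

lemma fock_act_vac_surj: "\<exists>a. v = fock_act a vac"
proof transfer
  fix v :: "'a falg_bc"
  show "\<exists>a. fock_rel v (a * 1)"
    by (intro exI[of _ v]) (simp add: fock_rel_def fock_ideal.zero)
qed

text \<open>
  The Fock space is a cyclic module over an algebra generated by the \<open>b(i)\<close> and \<open>c(i)\<close>.
\<close>

lemma fock_induct [case_names vac b c add scale]: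
  assumes "P vac" and "\<And>i v. P v \<Longrightarrow> P (fb i v)" and "\<And>i v. P v \<Longrightarrow> P (fc i v)"
    and "\<And>u v. P u \<Longrightarrow> P v \<Longrightarrow> P (u + v)" and "\<And>k v. P v \<Longrightarrow> P (fock_scale k v)"
  shows "P v"
proof -
  have "P (fock_act a vac)" for a
  proof (induction a rule: falg_induct)
    case (scal k)
    then show ?case using assms(1,5) by (simp flip: fock_scale_def)
  next
    case (gen g a)
    then show ?case using assms(2,3) by (cases g) (simp_all add: fock_act_mult b_op_def c_op_def)
  next
    case (add a b)
    then show ?case using assms(4) by (simp add: fock_act_add_left)
  qed
  then show ?thesis using fock_act_vac_surj by metis
qed

lemma factor_B_nilpotent:
  assumes "k \<ge> 2"
  shows "fock_act ((scal x * (b_op (- (i - 1)) * c_op (i - 2))) ^ k) v = 0"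
proof -
  obtain m where "k = Suc (Suc m)" using assms by (metis add_2_eq_Suc le_Suc_ex)
  then show ?thesis
    by (simp add: fock_act_mult c_b_anticomm fock_act_minus fock_act_uminus fock_act_scale flip: fock_scale_def)
qed

text \<open>
  The exponent squares to zero because its two letters anticommute and \<open>b(1 - i)\<^sup>2 = 0\<close>.
\<close>

lemma factor_B_eq: "factor_B x i v = v + fock_scale x (fb (- (i - 1)) (fc (i - 2) v))"
proof -
  let ?a = "scal x * (b_op (- (i - 1)) * c_op (i - 2))"
  have "factor_B x i v = (\<Sum>k\<in>{0, 1}. fock_scale (1 / fact k) (fock_act (?a ^ k) v))"
    unfolding factor_B_def fock_exp_def
  proof (rule Sum_any.expand_superset)
    show "{k. fock_scale (1 / fact k) (fock_act (?a ^ k) v) \<noteq> 0} \<subseteq> {0, 1}"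
      using factor_B_nilpotent[of _ x i v] by (auto simp: not_le_imp_less numeral_2_eq_2)
         (metis One_nat_def Suc_leI fock_scale_zero less_one nat_neq_iff numeral_2_eq_2)
  qed simp
  then show ?thesis
    by (simp add: fock_scale_simps fock_act_1 fock_act_mult flip: fock_scale_def)
qed

lemma factor_B_hom: "module_hom fock_scale fock_scale (factor_B x i)"
  by (auto simp: module_hom_iff module_fock_scale factor_B_eq fock_scale_simps fock_act_add
      fock_act_scale mult.commute)

text \<open>
  In a word only finitely many \<open>c(j)\<close> occur, so \<open>b(i)\<close> with \<open>i\<close> large anticommutes with all letters and
  reaches the vacuum, which it kills. This makes the infinite products stabilise.
\<close>

lemma b_eventually_zero: "\<exists>N. \<forall>i\<ge>N. fb i v = 0"
proof (induction v rule: fock_induct)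
  case vac
  show ?case by (intro exI[of _ 1]) (simp add: b_vac)
next
  case (b j v)
  then show ?case by (metis b_b_anticomm fock_act_zero neg_equal_0_iff_equal)
next
  case (c j v)
  then obtain N where "\<forall>i\<ge>N. fb i v = 0" by blast
  moreover have "fb i (fc j v) = (if i = - j then v else 0) - fc j (fb i v)" for i
    using c_b_anticomm[of j i v] by simp
  ultimately show ?case by (intro exI[of _ "max N (1 - j)"]) auto
next
  case (add u v)
  then obtain N N' where "\<forall>i\<ge>N. fb i u = 0" "\<forall>i\<ge>N'. fb i v = 0" by blast
  then show ?case by (intro exI[of _ "max N N'"]) (simp add: fock_act_add)
next
  case (scale k v)
  then show ?case by (metis fock_act_scale fock_scale_zero)
qed

lemma factor_B_stable: "\<exists>N. \<forall>i\<le>N. factor_B x i v = v"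
proof -
  obtain N where N: "\<forall>i\<ge>N. fb i v = 0" using b_eventually_zero by blast
  have "factor_B x i v = v" if "i \<le> 1 - N" for i
  proof -
    have "fb (- (i - 1)) (fc (i - 2) v) = - fc (i - 2) (fb (- (i - 1)) v)"
      using c_b_anticomm[of "i - 2" "- (i - 1)" v] by simp
    also have "fb (- (i - 1)) v = 0" using N that by simp
    finally show ?thesis by (simp add: factor_B_eq)
  qed
  then show ?thesis by blast
qed

lemma eventual_valueI:
  assumes "\<forall>\<^sub>F N in sequentially. f N = y"
  shows "eventual_value f = y"
  unfolding eventual_value_def
proof (rule the_equality)
  show "\<forall>\<^sub>F N in sequentially. f N = y" by (fact assms)
next
  fix z assume "\<forall>\<^sub>F N in sequentially. f N = z"
  with assms have "\<forall>\<^sub>F N in sequentially. z = y" by eventually_elim simp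
  then show "z = y" by simp
qed

text \<open>
  The top index is an arbitrary integer: stripping off the first row of a partition
  lowers it, eventually below zero.
\<close>

definition fermi_prod :: "int \<Rightarrow> 'k::field_char_0 \<Rightarrow> 'k fock \<Rightarrow> 'k fock" where
  "fermi_prod K x v = eventual_value (\<lambda>N. foldr (\<lambda>k. factor_B x (K - int k)) [0..<N] v)"

lemma fermi_B_eq: "fermi_B M = fermi_prod (int M)"
  by (simp add: fun_eq_iff fermi_B_def fermi_prod_def)

lemma fermi_prod_eventually:
  "\<forall>\<^sub>F N in sequentially. foldr (\<lambda>k. factor_B x (K - int k)) [0..<N] v = fermi_prod K x v"
proof -
  obtain B where B: "\<forall>i\<le>B. factor_B x i v = v" using factor_B_stable by blast
  define N where "N = nat (K - B)"
  have "foldr (\<lambda>k. factor_B x (K - int k)) [0..<N'] v = foldr (\<lambda>k. factor_B x (K - int k)) [0..<N] v"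
    if "N' \<ge> N" for N'
  proof -
    have "foldr (\<lambda>k. factor_B x (K - int k)) [N..<N'] v = v"
    proof -
      have "foldr (\<lambda>k. factor_B x (K - int k)) ks v = v" if "\<forall>k\<in>set ks. N \<le> k" for ks
        using that by (induction ks) (use B N_def in auto)
      then show ?thesis by simp
    qed
    then show ?thesis using that using upt_add_eq_append[of 0 N "N' - N"] by simp
  qed
  then have *: "\<forall>\<^sub>F N' in sequentially. foldr (\<lambda>k. factor_B x (K - int k)) [0..<N'] v
      = foldr (\<lambda>k. factor_B x (K - int k)) [0..<N] v"
    unfolding eventually_sequentially by blast
  then show ?thesis by (simp add: fermi_prod_def eventual_valueI[OF *])
qed

lemma fermi_prodI:
  assumes "\<forall>\<^sub>F N in sequentially. foldr (\<lambda>k. factor_B x (K - int k)) [0..<N] v = y"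
  shows "fermi_prod K x v = y"
  unfolding fermi_prod_def using assms by (rule eventual_valueI)

lemma fermi_prod_rec: "fermi_prod K x v = factor_B x K (fermi_prod (K - 1) x v)"
proof -
  have step: "foldr (\<lambda>k. factor_B x (K - int k)) [0..<Suc N] v
      = factor_B x K (foldr (\<lambda>k. factor_B x (K - 1 - int k)) [0..<N] v)" for N
    by (simp add: upt_conv_Cons foldr_map comp_def algebra_simps del: upt_Suc flip: map_Suc_upt)
  have "\<forall>\<^sub>F N in sequentially. foldr (\<lambda>k. factor_B x (K - int k)) [0..<Suc N] v
      = factor_B x K (fermi_prod (K - 1) x v)"
    using fermi_prod_eventually[of x "K - 1" v] unfolding step by eventually_elim simp
  then show ?thesis
    by (intro fermi_prodI) (simp only: eventually_sequentially_Suc[of "\<lambda>N. foldr (\<lambda>k. factor_B x (K - int k)) [0..<N] v = _"])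
qed

lemma fermi_prod_commute:
  assumes "\<And>i w. i \<le> K \<Longrightarrow> factor_B x i (P w) = P (factor_B x i w)"
  shows "fermi_prod K x (P v) = P (fermi_prod K x v)"
proof (rule fermi_prodI)
  have comm: "foldr (\<lambda>k. factor_B x (K - int k)) ks (P v) = P (foldr (\<lambda>k. factor_B x (K - int k)) ks v)" for ks
    by (induction ks) (simp_all add: assms)
  show "\<forall>\<^sub>F N in sequentially. foldr (\<lambda>k. factor_B x (K - int k)) [0..<N] (P v) = P (fermi_prod K x v)"
    using fermi_prod_eventually[of x K v] unfolding comm by eventually_elim simp
qed

lemma fermi_prod_hom: "module_hom fock_scale fock_scale (fermi_prod K x)"
  unfolding module_hom_iff
proof (intro conjI allI module_fock_scale)
  show "fermi_prod K x (fock_scale k v) = fock_scale k (fermi_prod K x v)" for k v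
    by (rule fermi_prod_commute) (simp add: module_hom.scale[OF factor_B_hom])
next
  fix u v
  have add: "foldr (\<lambda>k. factor_B x (K - int k)) ks (u + v)
      = foldr (\<lambda>k. factor_B x (K - int k)) ks u + foldr (\<lambda>k. factor_B x (K - int k)) ks v" for ks
    by (induction ks) (simp_all add: module_hom.add[OF factor_B_hom])
  show "fermi_prod K x (u + v) = fermi_prod K x u + fermi_prod K x v"
    by (rule fermi_prodI, unfold add, rule eventually_elim2[OF fermi_prod_eventually[of x K u]
          fermi_prod_eventually[of x K v]]) simp
qed

text \<open>
  The factors up to \<open>K\<close> move particles between positions below \<open>K\<close> only.
\<close>

lemma fermi_prod_b:
  assumes "K \<le> p"
  shows "fermi_prod K x (fb (- p) v) = fb (- p) (fermi_prod K x v)"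
proof (rule fermi_prod_commute)
  fix i w assume "i \<le> K"
  then have "p \<noteq> i - 2" using assms by simp
  then show "factor_B x i (fb (- p) w) = fb (- p) (factor_B x i w)"
    by (simp add: factor_B_eq c_b_anticomm fock_act_add fock_act_uminus fock_act_scale b_b_anticomm[of _ "- p"])
qed

lemma fermi_prod_c:
  assumes "K \<le> q"
  shows "fermi_prod K x (fc q v) = fc q (fermi_prod K x v)"
proof (rule fermi_prod_commute)
  fix i w assume "i \<le> K"
  then have "1 - i \<noteq> - q" using assms by simp
  then show "factor_B x i (fc q w) = fc q (factor_B x i w)"
    by (simp add: factor_B_eq c_b_anticomm fock_act_add fock_act_uminus fock_act_scale c_c_anticomm[of "i - 2" q])
qed

text \<open>
  The factor with index \<open>p + 1\<close> would move a particle onto position \<open>p\<close>, which is occupied.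
\<close>

lemma fermi_prod_top: "fermi_prod (p + 1) x (fb (- p) v) = fb (- p) (fermi_prod p x v)"
  using fermi_prod_rec[of "p + 1" x "fb (- p) v"]
  by (simp add: fermi_prod_b factor_B_eq c_b_anticomm fock_act_uminus)

text \<open>
  The hypothesis says that \<open>v\<close> has no particle at \<open>p\<close> or above. The lower particles move first, as they do
  in \<open>fermi_prod p x v\<close>, and cannot pass the one at \<open>p\<close>; afterwards that particle alone is moved on by the
  later factors, and it gains one power of \<open>x\<close> per step. Raising the top index by one therefore adds
  exactly the term in which it has arrived at the new topmost position. The invariant behind the induction
  is that removing the particle from the topmost position leaves \<open>x ^ n\<close> times the moved lower state.
\<close>

lemma fermi_prod_row:
  assumes "\<forall>q\<ge>p. fc q v = 0"
  shows "fermi_prod (p + int n + 2) x (fb (- p) v) =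
    fermi_prod (p + int n + 1) x (fb (- p) v)
      + fock_scale (x ^ Suc n) (fb (- (p + int n + 1)) (fermi_prod p x v))"
proof -
  define w y where "w = fermi_prod p x v" and "y n = fermi_prod (p + int n + 1) x (fb (- p) v)" for n
  have w: "fc q w = 0" if "q \<ge> p" for q
    using fermi_prod_c[OF that, of x v, symmetric] assms that
    by (simp add: w_def module_hom.zero[OF fermi_prod_hom])
  have above: "fc q (y n) = 0" if "q > p + int n" for q n
    using fermi_prod_c[of "p + int n + 1" q x "fb (- p) v", symmetric] that assms
    by (simp add: y_def c_b_anticomm module_hom.zero[OF fermi_prod_hom])
  have rec: "y (Suc n) = y n + fock_scale x (fb (- (p + int n + 1)) (fc (p + int n) (y n)))" for n
    using fermi_prod_rec[of "p + int (Suc n) + 1" x "fb (- p) v"]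
    by (simp add: y_def factor_B_eq algebra_simps)
  have lead: "fc (p + int n) (y n) = fock_scale (x ^ n) w" for n
  proof (induction n)
    case 0
    show ?case using w by (simp add: y_def fermi_prod_top c_b_anticomm fock_scale_simps flip: w_def)
  next
    case (Suc n)
    have "fc (p + int (Suc n)) (y (Suc n)) = fock_scale (x ^ Suc n) w"
      unfolding rec fock_act_add fock_act_scale Suc.IH using above[of n "p + int (Suc n)"] w[of "p + int (Suc n)"]
      by (simp add: c_b_anticomm fock_act_scale fock_scale_simps algebra_simps)
    then show ?case .
  qed
  show ?thesis
    using rec[of n] unfolding lead by (simp add: y_def w_def fock_act_scale fock_scale_simps algebra_simps)
qed

section \<open>Both operators grow a partition by a horizontal strip\<close>

text \<open>
  The vacuum has all positions \<open>m < 0\<close> filled; \<open>drained_vac j\<close> has only those with \<open>m < - j\<close> filled.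
\<close>

fun drained_vac :: "nat \<Rightarrow> 'k::field_char_0 fock" where
  "drained_vac 0 = vac"
| "drained_vac (Suc j) = fc (- int (Suc j)) (drained_vac j)"

text \<open>
  The rows of a partition placed from row \<open>j + 1\<close> on, that is, the state of the partition with its positions
  shifted down by \<open>j\<close> over a correspondingly lowered Fermi sea. The shift is what remains after the
  first \<open>j\<close> rows have been split off.
\<close>

fun row_state :: "nat \<Rightarrow> nat list \<Rightarrow> 'k::field_char_0 fock" where
  "row_state j [] = drained_vac j"
| "row_state j (a # \<mu>) = fb (- (int a - 1 - int j)) (row_state (Suc j) \<mu>)"

lemma c_drained_vac: "q \<ge> - int j \<Longrightarrow> fc q (drained_vac j :: 'k::field_char_0 fock) = 0"
proof (induction j)
  case (Suc j)
  show ?case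
  proof (cases "q = - int (Suc j)")
    case False
    then have "fc q (drained_vac j :: 'k fock) = 0" using Suc by simp
    then show ?thesis using c_c_anticomm[of q "- int (Suc j)" "drained_vac j :: 'k fock"] by simp
  qed simp
qed (simp add: c_vac)

lemma b_drained_vac: "r > int j \<Longrightarrow> fb r (drained_vac j :: 'k::field_char_0 fock) = 0"
proof (induction j)
  case (Suc j)
  then have "fb r (drained_vac j :: 'k fock) = 0" by simp
  then show ?case using c_b_anticomm[of "- int (Suc j)" r "drained_vac j :: 'k fock"] Suc.prems by simp
qed (simp add: b_vac)

text \<open>
  A row of length zero may be appended without changing the state; it is the row that grows when the strip
  adds a new part.
\<close>

lemma drained_vac_unfold: "(drained_vac j :: 'k::field_char_0 fock) = fb (int j + 1) (drained_vac (Suc j))"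
  using c_b_anticomm[of "- int (Suc j)" "int j + 1" "drained_vac j :: 'k fock"] b_drained_vac[of j "int j + 1", where 'k = 'k]
  by (simp add: algebra_simps)

text \<open>
  All positions that the factors up to \<open>- j\<close> could move a particle to are occupied. Commuting with the
  constant map \<open>\<lambda>_. drained_vac j\<close> is invariance of this vector.
\<close>

lemma fermi_prod_drained_vac:
  fixes x :: "'k::field_char_0"
  assumes "K \<le> - int j"
  shows "fermi_prod K x (drained_vac j) = drained_vac j"
proof -
  have "factor_B x i (drained_vac j) = drained_vac j" if "i \<le> K" for i
    using c_b_anticomm[of "i - 2" "1 - i" "drained_vac j :: 'k fock"] b_drained_vac[of j "1 - i", where 'k = 'k] that assms
    by (simp add: factor_B_eq)
  then have "fermi_prod K x ((\<lambda>_. drained_vac j) (drained_vac j :: 'k fock)) = (\<lambda>_. drained_vac j) (fermi_prod K x (drained_vac j))"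
    by (intro fermi_prod_commute) simp
  then show ?thesis by simp
qed

lemma c_row_state:
  assumes "\<And>m. m \<in> set \<mu> \<Longrightarrow> int m \<le> q + int j" "q \<ge> - int j"
  shows "fc q (row_state j \<mu> :: 'k::field_char_0 fock) = 0"
  using assms
proof (induction \<mu> arbitrary: j)
  case (Cons a \<mu>)
  have "fc q (row_state (Suc j) \<mu> :: 'k fock) = 0"
  proof (rule Cons.IH)
    show "int m \<le> q + int (Suc j)" if "m \<in> set \<mu>" for m using Cons.prems(1)[of m] that by simp
  qed (use Cons.prems in simp)
  moreover have "int a \<le> q + int j" using Cons.prems by simp
  ultimately show ?case by (simp add: c_b_anticomm)
qed (simp add: c_drained_vac)

definition top_part :: "nat list \<Rightarrow> nat" where
  "top_part \<mu> = (case \<mu> of [] \<Rightarrow> 0 | a # _ \<Rightarrow> a)"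

text \<open>
  With the conventions \<open>top_part [] = 0\<close> and \<open>tl [] = []\<close> the empty partition is covered, its first row being an
  empty one.
\<close>

lemma row_state_split:
  "row_state j \<mu> = fb (- (int (top_part \<mu>) - 1 - int j)) (row_state (Suc j) (tl \<mu>))"
  using drained_vac_unfold[of j] by (cases \<mu>) (simp_all add: top_part_def algebra_simps)

lemma occ_partition_Suc:
  "occ_partition (Suc M) n = replicate (n (Suc M)) (Suc M) @ occ_partition M n"
  by (simp add: occ_partition_def)

lemma occ_partition_le: "m \<in> set (occ_partition M n) \<Longrightarrow> m \<le> M"
  by (auto simp: occ_partition_def)

lemma sorted_occ_partition: "sorted_wrt (\<ge>) (occ_partition M n)"
proof (induction M)
  case 0
  show ?case by (simp add: occ_partition_def)
next
  case (Suc M)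
  have "sorted_wrt (\<ge>) (replicate k (Suc M))" for k by (induction k) auto
  then show ?case using Suc occ_partition_le by (fastforce simp: occ_partition_Suc sorted_wrt_append)
qed

lemma tl_le_top_part: "sorted_wrt (\<ge>) \<mu> \<Longrightarrow> m \<in> set (tl \<mu>) \<Longrightarrow> m \<le> top_part \<mu>"
  by (cases \<mu>) (auto simp: top_part_def)

lemma occ_partition_cong: "(\<And>i. 1 \<le> i \<Longrightarrow> i \<le> M \<Longrightarrow> n i = n' i) \<Longrightarrow> occ_partition M n = occ_partition M n'"
  unfolding occ_partition_def by (intro arg_cong[where f = concat] map_cong) auto

lemma occ_partition_raise:
  "occ_partition (Suc M) (n(Suc M := Suc (n (Suc M)))) = Suc M # occ_partition (Suc M) n"
  using occ_partition_cong[of M "n(Suc M := Suc (n (Suc M)))" n] by (simp add: occ_partition_Suc)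

text \<open>
  \<open>Mbc M\<close> is the case \<open>j = 0\<close> (lemma \<open>Mbc_eq\<close>); prepending a part changes \<open>j\<close>, so the induction needs all \<open>j\<close>.
\<close>

definition row_map :: "nat \<Rightarrow> nat \<Rightarrow> 'k::field_char_0 ket \<Rightarrow> 'k fock" where
  "row_map j M = lin_ext fock_scale (\<lambda>n. row_state j (occ_partition M n))"

lemma row_map_hom: "module_hom phase_scale fock_scale (row_map j M)"
  unfolding row_map_def phase_scale_eq by (rule lin_ext_hom[OF module_fock_scale])

lemma row_map_single: "row_map j M (Poly_Mapping.single n 1) = row_state j (occ_partition M n)"
  by (simp add: row_map_def lin_ext_single module_fock_scale fock_scale_simps)

lemma row_map_Suc: "v \<in> ket_space M \<Longrightarrow> row_map j (Suc M) v = row_map j M v"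
  unfolding row_map_def lin_ext_def
  by (intro sum.cong) (auto simp: ket_space_def occ_partition_Suc)

lemma row_map_raise:
  "row_map j (Suc M) (raise_occ (Suc M) v) = fb (- (int M - int j)) (row_map (Suc j) (Suc M) v)"
proof -
  have "(row_map j (Suc M) \<circ> raise_occ (Suc M)) v
      = (fb (- (int M - int j)) \<circ> row_map (Suc j) (Suc M)) v"
    by (rule phase_hom_eqI[OF module_hom_compose[OF raise_hom row_map_hom]
          module_hom_compose[OF row_map_hom fock_act_hom]])
       (simp add: raise_single row_map_single occ_partition_raise)
  then show ?thesis by simp
qed

text \<open>
  A part of the largest possible size \<open>Suc m\<close> cannot grow, so it is a spectator for \<open>strip\<close>; in \<open>open_strip\<close>, one
  copy of it is necessarily the part in transit.
\<close>

lemma strip_raise_top: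
  "strip x (Suc m) (raise_occ (Suc m) v) = raise_occ (Suc m) (strip x (Suc m) v)"
  "open_strip x (Suc m) (raise_occ (Suc m) v) = phase_scale x (strip x (Suc m) v)"
  by (simp_all add: strip_raise_commute lower_raise_same module_hom.add[OF raise_hom])

lemma strip_lower_top:
  assumes "n (Suc m) = 0"
  shows "lower_occ (Suc m) (strip x m (Poly_Mapping.single n 1)) = 0"
  using assms by (simp add: lower_single module_hom.zero[OF strip_hom(1)] flip: strip_lower_commute)

lemma single_ket_space: "(\<And>i. i > M \<Longrightarrow> n i = 0) \<Longrightarrow> Poly_Mapping.single n 1 \<in> ket_space M"
  by (auto simp: ket_space_def)

text \<open>
  Both halves are needed together: the recursion of \<open>strip\<close> calls \<open>open_strip\<close>, and conversely.
  For \<open>open_strip\<close> the first row, of length \<open>a\<close>, has been detached after growing to length \<open>M + 1\<close>, at the cost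
  \<open>x ^ (M + 1 - a)\<close>, and the remaining rows have grown below its original position. If no part equals the
  new largest size, the recursion of \<open>strip\<close> is \<open>fermi_prod_row\<close>; otherwise such a part is split off and
  \<open>fermi_prod_top\<close> applies.
\<close>

lemma row_map_strip:
  fixes x :: "'k::field_char_0"
  assumes "\<forall>i>M. n i = 0"
  shows "row_map j M (strip x M (Poly_Mapping.single n 1))
        = fermi_prod (int M - int j) x (row_state j (occ_partition M n))
      \<and> row_map (Suc j) M (open_strip x M (Poly_Mapping.single n 1))
        = fock_scale (x ^ (Suc M - top_part (occ_partition M n)))
            (fermi_prod (int (top_part (occ_partition M n)) - 1 - int j) x
              (row_state (Suc j) (tl (occ_partition M n))))"
    (is "?strip M n j \<and> ?open_strip M n j")
  using assms
proof (induction M arbitrary: n j)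
  case 0
  have [simp]: "occ_partition 0 n = []" for n by (simp add: occ_partition_def)
  have "?strip 0 n j"
    by (simp add: raise_single row_map_single fermi_prod_drained_vac)
  moreover have "?open_strip 0 n j"
    using fermi_prod_drained_vac[of "-1 - int j" "Suc j" x]
    by (simp add: module_hom.scale[OF row_map_hom] row_map_single top_part_def del: drained_vac.simps)
  ultimately show ?case by blast
next
  case (Suc M)
  define k where "k = n (Suc M)"
  show ?case
    using Suc.prems k_def
  proof (induction k arbitrary: n j)
    case 0
    have n: "\<forall>i>M. n i = 0"
      using 0 by (metis Suc_lessI)
    let ?v = "Poly_Mapping.single n 1 :: 'k ket"
    define \<nu> where "\<nu> = occ_partition M n"
    define a where "a = top_part \<nu>"
    define \<Phi> where "\<Phi> = (row_state (Suc j) (tl \<nu>) :: 'k fock)"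
    have \<nu>: "occ_partition (Suc M) n = \<nu>" using n by (simp add: occ_partition_Suc \<nu>_def)
    have "a \<le> M"
      using occ_partition_le[of _ M n] by (cases \<nu>) (auto simp: a_def top_part_def \<nu>_def)
    have kills: "\<forall>q\<ge>int a - 1 - int j. fc q \<Phi> = 0"
      unfolding \<Phi>_def
    proof (intro allI impI c_row_state)
      fix q m assume q: "q \<ge> int a - 1 - int j" and "m \<in> set (tl \<nu>)"
      then have "m \<le> a" using tl_le_top_part[OF sorted_occ_partition] by (simp add: a_def \<nu>_def)
      then show "int m \<le> q + int (Suc j)" using q by simp
    qed simp
    have space: "strip x M ?v \<in> ket_space M" "open_strip x M ?v \<in> ket_space M"
      using n by (simp_all add: strip_ket_space single_ket_space)
    have row: "row_state j \<nu> = fb (- (int a - 1 - int j)) \<Phi>"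
      using row_state_split by (simp add: a_def \<Phi>_def)
    have open_strip: "row_map (Suc j) M (open_strip x M ?v)
        = fock_scale (x ^ (Suc M - a)) (fermi_prod (int a - 1 - int j) x \<Phi>)"
      using Suc.IH[of n j, OF n, THEN conjunct2] by (simp add: a_def \<Phi>_def \<nu>_def)
    have "row_map j (Suc M) (strip x (Suc M) ?v)
      = fermi_prod (int M - int j) x (row_state j \<nu>)
        + fock_scale (x ^ (Suc M - a)) (fb (- (int M - int j)) (fermi_prod (int a - 1 - int j) x \<Phi>))"
      using Suc.IH[of n j, OF n, THEN conjunct1]
      by (simp add: module_hom.add[OF row_map_hom] row_map_raise row_map_Suc space open_strip
          fock_act_scale \<nu>_def)
    also have "\<dots> = fermi_prod (int (Suc M) - int j) x (row_state j \<nu>)"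
      using fermi_prod_row[OF kills, of "M - a" x] \<open>a \<le> M\<close>
      by (simp add: row of_nat_diff algebra_simps Suc_diff_le)
    finally have strip: "?strip (Suc M) n j"
      by (simp add: \<nu>)
    have "Suc (Suc M) - a = Suc (Suc M - a)" using \<open>a \<le> M\<close> by simp
    then have "?open_strip (Suc M) n j"
      using n
      by (simp add: \<nu> module_hom.scale[OF row_map_hom] strip_lower_top row_map_Suc space open_strip
          fock_scale_simps flip: a_def \<Phi>_def)
    with strip show ?case by blast
  next
    case (Suc k)
    define n' where "n' = n(Suc M := k)"
    have n': "\<forall>i>Suc M. n' i = 0" and n'_k: "k = n' (Suc M)"
      using Suc.prems by (simp_all add: n'_def)
    have n: "n = n'(Suc M := Suc (n' (Suc M)))"
      using Suc.prems(2) by (auto simp: n'_def)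
    have single: "Poly_Mapping.single n 1 = raise_occ (Suc M) (Poly_Mapping.single n' (1 :: 'k))"
      by (subst n) (simp add: raise_single)
    have part: "occ_partition (Suc M) n = Suc M # occ_partition (Suc M) n'"
      by (subst n) (rule occ_partition_raise)
    have IH: "row_map (Suc j) (Suc M) (strip x (Suc M) (Poly_Mapping.single n' 1))
        = fermi_prod (int M - int j) x (row_state (Suc j) (occ_partition (Suc M) n'))"
      using Suc.IH[of n' "Suc j", OF n' n'_k, THEN conjunct1] by simp
    have "?strip (Suc M) n j"
      using fermi_prod_top[of "int M - int j" x "row_state (Suc j) (occ_partition (Suc M) n')"]
      unfolding single strip_raise_top row_map_raise IH part by (simp add: algebra_simps)
    moreover have "?open_strip (Suc M) n j"
      unfolding single strip_raise_top module_hom.scale[OF row_map_hom] IH part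
      by (simp add: top_part_def)
    ultimately show ?case by blast
  qed
qed

lemma drained_vac_eq: "drained_vac l = fock_act (prod_list (map (\<lambda>j. c_op (- int j)) (rev [1..<l + 1]))) vac"
  by (induction l) (simp_all add: fock_act_1 fock_act_mult)

lemma row_state_eq:
  "row_state j \<mu> = fock_act (prod_list (map (\<lambda>i. b_op (- (int (\<mu> ! (i - 1)) - int i - int j))) [1..<length \<mu> + 1]))
     (drained_vac (j + length \<mu>))"
proof (induction \<mu> arbitrary: j)
  case (Cons a \<mu>)
  have upt: "[1..<length (a # \<mu>) + 1] = 1 # map Suc [1..<length \<mu> + 1]"
    by (simp add: upt_conv_Cons map_Suc_upt del: upt_Suc)
  have map: "map ((\<lambda>i. b_op (- (int ((a # \<mu>) ! (i - 1)) - int i - int j))) \<circ> Suc) [1..<length \<mu> + 1]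
      = map (\<lambda>i. b_op (- (int (\<mu> ! (i - 1)) - int i - int (Suc j)))) [1..<length \<mu> + 1]"
    by (intro map_cong) (auto simp: nth_Cons' intro!: arg_cong[of _ _ b_op])
  show ?case
    unfolding upt list.map map_map map prod_list.Cons fock_act_mult row_state.simps Cons.IH
    by simp
qed (simp add: fock_act_1)

lemma part_ket_eq: "part_ket \<mu> = row_state 0 \<mu>"
  by (subst row_state_eq) (simp add: part_ket_def fock_act_mult drained_vac_eq shifted_part_def del: upt_Suc)

lemma Mbc_eq: "Mbc M = row_map 0 M"
  by (simp add: Mbc_def row_map_def part_ket_eq)

lemma Mbc_strip:
  assumes "v \<in> ket_space M"
  shows "Mbc M (strip x M v) = fermi_B M x (Mbc M v)"
proof -
  have "(row_map 0 M \<circ> strip x M) v = (fermi_prod (int M) x \<circ> row_map 0 M) v"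
  proof (rule phase_hom_eqI[OF module_hom_compose[OF strip_hom(1) row_map_hom]
          module_hom_compose[OF row_map_hom fermi_prod_hom]])
    fix n assume "n \<in> Poly_Mapping.keys v"
    then have "\<forall>i>M. n i = 0"
      using assms by (auto simp: ket_space_def)
    with row_map_strip[of M n 0 x, THEN conjunct1]
    show "(row_map 0 M \<circ> strip x M) (Poly_Mapping.single n 1)
        = (fermi_prod (int M) x \<circ> row_map 0 M) (Poly_Mapping.single n 1)"
      by (simp add: row_map_single)
  qed
  then show ?thesis by (simp add: Mbc_eq fermi_B_eq)
qed

section \<open>Charge zero\<close>

text \<open>
  Unlike balancedness, the difference of the numbers of \<open>b\<close>'s and \<open>c\<close>'s is additive and makes sense for the
  factors of a balanced product.
\<close>

definition excess :: "fermi_gen list \<Rightarrow> int" where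
  "excess w = int (length (filter (\<lambda>g. \<exists>i. g = Fb i) w)) - int (length (filter (\<lambda>g. \<exists>i. g = Fc i) w))"

definition charged :: "int \<Rightarrow> 'k::zero falg_bc \<Rightarrow> bool" where
  "charged d a \<longleftrightarrow> (\<forall>w\<in>Poly_Mapping.keys a. excess w = d)"

lemma balanced_charged: "balanced a \<longleftrightarrow> charged 0 a"
  by (simp add: balanced_def charged_def excess_def)

lemma charged_add: "charged d a \<Longrightarrow> charged d b \<Longrightarrow> charged d (a + b)"
  using keys_add[of a b] by (auto simp: charged_def)

lemma excess_append: "excess (u @ v) = excess u + excess v"
  by (simp add: excess_def)

lemma charged_mult:
  fixes a b :: "'k::field falg_bc"
  assumes "charged d a" "charged e b"
  shows "charged (d + e) (a * b)"
proof -
  have "excess w = d + e" if "w \<in> Poly_Mapping.keys (a * b)" for w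
  proof -
    have "w \<in> {u + v |u v. u \<in> Poly_Mapping.keys a \<and> v \<in> Poly_Mapping.keys b}"
      using that keys_mult by blast
    then obtain u v where "w = u @ v" "u \<in> Poly_Mapping.keys a" "v \<in> Poly_Mapping.keys b"
      by (auto simp: plus_list_def)
    then show ?thesis using assms by (auto simp: charged_def excess_append)
  qed
  then show ?thesis by (simp add: charged_def)
qed

lemma charged_gens:
  shows "charged 1 (b_op i :: 'k::field falg_bc)" "charged (- 1) (c_op i :: 'k falg_bc)"
    "charged 0 (scal k :: 'k falg_bc)" "charged 0 (1 :: 'k falg_bc)"
  by (auto simp: charged_def excess_def b_op_def c_op_def gen_def scal_def zero_list_def
      simp flip: single_one)

lemma charged_prod_list:
  "(\<And>a. a \<in> set as \<Longrightarrow> charged d a) \<Longrightarrow> charged (d * int (length as)) (prod_list as)"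
  for as :: "'k::field falg_bc list"
proof (induction as)
  case (Cons a as)
  then have "charged (d + d * int (length as)) (a * prod_list as)"
    by (intro charged_mult) auto
  then show ?case by (simp add: algebra_simps)
qed (simp add: charged_gens)

lemma fock0_add: "u \<in> fock0 \<Longrightarrow> v \<in> fock0 \<Longrightarrow> u + v \<in> fock0"
  unfolding fock0_def balanced_charged by (auto simp flip: fock_act_add_left intro: charged_add)

lemma fock0_act: "charged 0 a \<Longrightarrow> v \<in> fock0 \<Longrightarrow> fock_act a v \<in> fock0"
  unfolding fock0_def balanced_charged using charged_mult[of 0 a 0]
  by (auto simp flip: fock_act_mult)

lemma fock0_zero: "0 \<in> fock0"
proof -
  have "(0 :: 'a fock) = fock_act 0 vac"
    using fock_act_add_left[of 0 0 vac] by simp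
  then show ?thesis by (force simp: fock0_def balanced_def)
qed

lemma part_ket_fock0: "part_ket \<mu> \<in> fock0"
proof -
  let ?b = "map (\<lambda>i. b_op (- shifted_part \<mu> i) :: 'a falg_bc) [1..<length \<mu> + 1]"
  let ?c = "map (\<lambda>j. c_op (- int j) :: 'a falg_bc) (rev [1..<length \<mu> + 1])"
  have "charged (1 * int (length ?b) + (- 1) * int (length ?c)) (prod_list ?b * prod_list ?c)"
    by (intro charged_mult charged_prod_list) (auto simp: charged_gens)
  then show ?thesis by (auto simp: part_ket_def fock0_def balanced_charged)
qed

lemma Mbc_fock0: "Mbc M v \<in> fock0"
proof -
  have "sum f A \<in> fock0" if "\<And>n. n \<in> A \<Longrightarrow> f n \<in> fock0" for A :: "occ set" and f :: "occ \<Rightarrow> 'a fock"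
    using that by (induction A rule: infinite_finite_induct) (auto simp: fock0_zero fock0_add)
  then show ?thesis
    unfolding Mbc_def lin_ext_def fock_scale_def by (simp add: fock0_act charged_gens part_ket_fock0)
qed

lemma factor_B_fock0: "v \<in> fock0 \<Longrightarrow> factor_B x i v \<in> fock0"
  using charged_mult[OF charged_gens(1,2), of "- (i - 1)" "i - 2"]
  by (auto simp: factor_B_eq fock_scale_def fock_act_mult[symmetric, of "b_op _"]
      intro!: fock0_add fock0_act charged_gens)

lemma fermi_B_fock0:
  assumes "v \<in> fock0"
  shows "fermi_B M x v \<in> fock0"
proof -
  have "foldr (\<lambda>k. factor_B x (int M - int k)) ks v \<in> fock0" for ks
    using assms by (induction ks) (simp_all add: factor_B_fock0)
  moreover obtain N where "foldr (\<lambda>k. factor_B x (int M - int k)) [0..<N] v = fermi_B M x v"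
    using eventually_happens[OF fermi_prod_eventually[of x "int M" v]] by (auto simp: fermi_B_eq)
  ultimately show ?thesis by metis
qed

section \<open>Transposition to the dual Fock space\<close>

text \<open>
  Together with the reversal of words this is the anti-involution \<open>b(i) \<leftrightarrow> c(-i)\<close> of the Clifford algebra.
\<close>

fun flip_gen :: "fermi_gen \<Rightarrow> fermi_gen" where
  "flip_gen (Fb i) = Fc (- i)"
| "flip_gen (Fc i) = Fb (- i)"

definition mirror :: "'k::field falg_bc \<Rightarrow> 'k falg_bc" where
  "mirror = lin_ext pscale (\<lambda>w. Poly_Mapping.single (rev (map flip_gen w)) 1)"

lemma mirror_hom: "module_hom pscale pscale mirror"
  unfolding mirror_def by (rule lin_ext_hom[OF module_pscale])

lemma mirror_single: "mirror (Poly_Mapping.single w k) = Poly_Mapping.single (rev (map flip_gen w)) k"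
  by (simp add: mirror_def lin_ext_single module_pscale)

lemma mirror_scal: "mirror (scal k) = scal k"
  by (simp add: scal_def mirror_single)

lemma mirror_gen: "mirror (gen g) = gen (flip_gen g)"
  by (simp add: gen_def mirror_single)

lemma mult_gen_hom: "module_hom pscale pscale (\<lambda>b. b * a)" for a :: "('g, 'k::comm_ring_1) falg"
  by (simp add: module_hom_iff module_pscale pscale_scal distrib_right mult.assoc)

lemma mirror_mult: "mirror (a * b) = mirror b * mirror a"
proof (induction a rule: falg_induct)
  case (scal k)
  show ?case
    using module_hom.scale[OF mirror_hom, of k b] by (simp add: pscale_scal mirror_scal scal_central)
next
  case (gen g a)
  have gen: "mirror (gen g * a) = mirror a * gen (flip_gen g)" for a
    by (rule hom_eqI[OF module_hom_compose[OF gen_mult_hom mirror_hom, unfolded o_def]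
          module_hom_compose[OF mirror_hom mult_gen_hom, unfolded o_def]])
       (simp add: gen_def mult_single mirror_single plus_list_def)
  show ?case unfolding mult.assoc gen using gen.IH by (simp add: mult.assoc)
next
  case (add a b)
  then show ?case by (simp add: distrib_left distrib_right module_hom.add[OF mirror_hom])
qed

lemma mirror_mirror: "mirror (mirror a) = a"
proof (induction a rule: falg_induct)
  case (gen g a)
  then show ?case by (cases g) (simp_all add: mirror_mult mirror_gen)
qed (simp_all add: mirror_scal module_hom.add[OF mirror_hom])

lemma mirror_1: "mirror 1 = 1"
  using mirror_scal[of 1] by (simp add: scal_1)

lemma mirror_ops: "mirror (b_op i) = c_op (- i)" "mirror (c_op i) = b_op (- i)"
  by (simp_all add: b_op_def c_op_def mirror_gen)

lemma mirror_power: "mirror (a ^ k) = mirror a ^ k"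
  by (induction k) (simp_all add: mirror_1 mirror_mult power_commutes)

lemma mirror_prod_list: "mirror (prod_list as) = prod_list (rev (map mirror as))"
  by (induction as) (simp_all add: mirror_1 mirror_mult)

lemma mirror_anticomm: "mirror (anticomm a b) = anticomm (mirror a) (mirror b)"
  by (simp add: anticomm_def module_hom.add[OF mirror_hom] mirror_mult add.commute)

lemma mirror_clifford_rels: "r \<in> clifford_rels \<Longrightarrow> mirror r \<in> clifford_rels"
proof -
  have comm: "anticomm u v = anticomm v u" for u v :: "'a falg_bc"
    by (simp add: anticomm_def add.commute)
  have one: "mirror (if P then 1 else 0) = (if P then 1 else 0 :: 'a falg_bc)" for P
    by (simp add: mirror_1 module_hom.zero[OF mirror_hom])
  assume "r \<in> clifford_rels"
  then consider (bc) i j where "r = anticomm (b_op i) (c_op j) - (if i = - j then 1 else 0)"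
    | (bb) i j where "r = anticomm (b_op i) (b_op j)"
    | (cc) i j where "r = anticomm (c_op i) (c_op j)"
    unfolding clifford_rels_def by blast
  then show ?thesis
  proof cases
    case bc
    then have "mirror r = anticomm (b_op (- j)) (c_op (- i)) - (if - j = - (- i) then 1 else 0)"
      by (auto simp: module_hom.diff[OF mirror_hom] mirror_anticomm mirror_ops one comm)
    then show ?thesis unfolding clifford_rels_def by blast
  next
    case bb
    then show ?thesis by (auto simp: mirror_anticomm mirror_ops clifford_rels_def)
  next
    case cc
    then show ?thesis by (auto simp: mirror_anticomm mirror_ops clifford_rels_def)
  qed
qed

lemma mirror_vac_annihilators:
  assumes "k \<in> vac_annihilators"
  shows "mirror k \<in> dual_vac_annihilators"
proof -
  consider m where "m \<ge> 0" "k = b_op (m + 1)" | m where "m \<ge> 0" "k = c_op m"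
    using assms unfolding vac_annihilators_def by blast
  then show ?thesis
  proof cases
    case 1
    then show ?thesis
      unfolding dual_vac_annihilators_def by (auto simp: mirror_ops intro!: exI[of _ "- (m + 1)"])
  next
    case 2
    then show ?thesis
      unfolding dual_vac_annihilators_def by (auto simp: mirror_ops intro!: exI[of _ "- m - 1"])
  qed
qed

text \<open>
  The anti-involution permutes the Clifford relations and turns the letters that kill the vacuum from
  the left into those that kill the dual vacuum from the right.
\<close>

lemma mirror_fock_ideal: "u \<in> fock_ideal \<Longrightarrow> mirror u \<in> dual_fock_ideal"
proof (induction rule: fock_ideal.induct)
  case zero
  show ?case by (simp add: module_hom.zero[OF mirror_hom] dual_fock_ideal.zero)
next
  case (add u v)
  then show ?case by (simp add: module_hom.add[OF mirror_hom] dual_fock_ideal.add)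
next
  case (cliff r u w)
  then show ?case
    using dual_fock_ideal.cliff[OF mirror_clifford_rels, of r "mirror w" "mirror u"]
    by (simp add: mirror_mult mult.assoc)
next
  case (vac k u)
  then show ?case
    using dual_fock_ideal.vac[OF mirror_vac_annihilators] by (simp add: mirror_mult)
qed

lift_definition mirror_fock :: "'k::field_char_0 fock \<Rightarrow> 'k dual_fock" is mirror
  unfolding fock_rel_def dual_fock_rel_def
  by (simp add: mirror_fock_ideal flip: module_hom.diff[OF mirror_hom])

lemma mirror_fock_act: "mirror_fock (fock_act a v) = dual_fock_act (mirror_fock v) (mirror a)"
  by transfer (simp add: mirror_mult dual_fock_rel_def dual_fock_ideal.zero)

lemma mirror_fock_add: "mirror_fock (u + v) = mirror_fock u + mirror_fock v"
  by transfer (simp add: module_hom.add[OF mirror_hom] dual_fock_rel_def dual_fock_ideal.zero)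

lemma mirror_fock_0: "mirror_fock 0 = 0"
  using mirror_fock_add[of 0 0] by simp

lemma mirror_fock_sum: "mirror_fock (sum f A) = (\<Sum>n\<in>A. mirror_fock (f n))"
  by (induction A rule: infinite_finite_induct) (simp_all add: mirror_fock_0 mirror_fock_add)

lemma mirror_fock_vac: "mirror_fock vac = dual_vac"
  by transfer (simp add: mirror_1 dual_fock_rel_def dual_fock_ideal.zero)

lemma mirror_fock_scale: "mirror_fock (fock_scale k v) = dual_fock_scale k (mirror_fock v)"
  by (simp add: fock_scale_def dual_fock_scale_def mirror_fock_act mirror_scal)

text \<open>
  The anti-involution sends \<open>b(1 - i) c(i - 2)\<close> to \<open>b(2 - i) c(i - 1)\<close>. The exponential series is compared
  as a finite sum, for \<^const>\<open>Sum_any\<close> need not commute with a map that is not known to be injective.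
\<close>

lemma factor_C_mirror: "factor_C x i (mirror_fock v) = mirror_fock (factor_B x i v)"
proof -
  let ?a = "scal x * (b_op (- (i - 1)) * c_op (i - 2))"
  let ?a' = "scal x * (b_op (- i + 2) * c_op (i - 1))"
  let ?term = "\<lambda>k. fock_scale (1 / fact k) (fock_act (?a ^ k) v)"
  have a: "?a' = mirror ?a"
    by (simp add: mirror_mult mirror_ops mirror_scal scal_central mult.assoc)
  have zero: "?term k = 0" if "k \<notin> {0, 1}" for k
    using that factor_B_nilpotent[of k x i v] by simp
  have "factor_C x i (mirror_fock v) = Sum_any (\<lambda>k. mirror_fock (?term k))"
    unfolding factor_C_def dual_fock_exp_def a
    by (simp only: mirror_fock_scale mirror_fock_act mirror_power)
  also have "\<dots> = (\<Sum>k\<in>{0, 1}. mirror_fock (?term k))"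
  proof (rule Sum_any.expand_superset)
    show "{k. mirror_fock (?term k) \<noteq> 0} \<subseteq> {0, 1}" using zero mirror_fock_0 by (metis (mono_tags, lifting) mem_Collect_eq subsetI)
  qed simp
  also have "\<dots> = mirror_fock (\<Sum>k\<in>{0, 1}. ?term k)"
    by (simp only: mirror_fock_sum)
  also have "(\<Sum>k\<in>{0, 1}. ?term k) = factor_B x i v"
    unfolding factor_B_def fock_exp_def
  proof (rule Sum_any.expand_superset[symmetric])
    show "{k. ?term k \<noteq> 0} \<subseteq> {0, 1}" using zero by (metis (mono_tags, lifting) mem_Collect_eq subsetI)
  qed simp
  finally show ?thesis .
qed

lemma fermi_C_mirror: "fermi_C M x (mirror_fock v) = mirror_fock (fermi_B M x v)"
proof -
  have "foldr (\<lambda>k. factor_C x (int M - int k)) ks (mirror_fock v)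
      = mirror_fock (foldr (\<lambda>k. factor_B x (int M - int k)) ks v)" for ks
    by (induction ks) (simp_all add: factor_C_mirror)
  then have "\<forall>\<^sub>F N in sequentially. foldr (\<lambda>k. factor_C x (int M - int k)) [0..<N] (mirror_fock v) = mirror_fock (fermi_B M x v)"
    using fermi_prod_eventually[of x "int M" v] by (auto simp: fermi_B_eq elim: eventually_mono)
  then show ?thesis unfolding fermi_C_def by (rule eventual_valueI)
qed

lemma part_bra_mirror: "part_bra \<mu> = mirror_fock (part_ket \<mu>)"
  by (simp add: part_bra_def part_ket_def mirror_fock_act mirror_fock_vac mirror_mult mirror_prod_list
      mirror_ops rev_map comp_def del: upt_Suc)

lemma Mbc_dual_eq: "Mbc_dual M v = mirror_fock (Mbc M v)"
  by (simp add: Mbc_dual_def Mbc_def lin_ext_def mirror_fock_sum mirror_fock_scale part_bra_mirror)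

lemma balanced_mirror:
  assumes "balanced a"
  shows "balanced (mirror a)"
proof -
  have excess: "excess (rev (map flip_gen w)) = - excess w" for w
  proof (induction w)
    case (Cons g w)
    then show ?case by (cases g) (simp_all add: excess_def)
  qed (simp add: excess_def)
  have "charged 0 (pscale k (Poly_Mapping.single (rev (map flip_gen w)) 1))" if "w \<in> Poly_Mapping.keys a"
    for w and k :: 'a
    using that assms by (auto simp: balanced_charged charged_def excess)
  moreover have "charged 0 (sum f A)" if "\<And>n. n \<in> A \<Longrightarrow> charged 0 (f n)"
    for A and f :: "fermi_gen list \<Rightarrow> 'a falg_bc"
    using that by (induction A rule: infinite_finite_induct) (auto simp: charged_add charged_def[of 0 0])
  ultimately show ?thesis by (simp add: balanced_charged mirror_def lin_ext_def)
qed

lemma dual_fock0_eq: "dual_fock0 = mirror_fock ` fock0"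
proof (intro equalityI subsetI)
  fix u :: "'a dual_fock" assume "u \<in> dual_fock0"
  then obtain a where "u = dual_fock_act dual_vac a" "balanced a" by (auto simp: dual_fock0_def)
  then have "u = mirror_fock (fock_act (mirror a) vac)" "balanced (mirror a)"
    by (simp_all add: mirror_fock_act mirror_mirror mirror_fock_vac balanced_mirror)
  then show "u \<in> mirror_fock ` fock0" by (auto simp: fock0_def)
qed (auto simp: fock0_def dual_fock0_def mirror_fock_act mirror_fock_vac intro: balanced_mirror)

theorem propositionB2:
  fixes M :: nat and x s :: "'k::field_char_0"
  assumes "M \<ge> 1" and "x \<noteq> 0" and "s ^ 2 = x"
  shows
    "(phase_B M s \<in> ket_space M \<rightarrow> ket_space M \<and>
      Mbc M \<in> ket_space M \<rightarrow> (fock0 :: 'k fock set) \<and>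
      fermi_B M x \<in> fock0 \<rightarrow> fock0 \<and>
      (\<forall>v\<in>ket_space M. Mbc M (phase_B M s v) = fermi_B M x (Mbc M v))) \<and>
     (phase_C M s \<in> bra_space M \<rightarrow> bra_space M \<and>
      Mbc_dual M \<in> bra_space M \<rightarrow> (dual_fock0 :: 'k dual_fock set) \<and>
      fermi_C M x \<in> dual_fock0 \<rightarrow> dual_fock0 \<and>
      (\<forall>v\<in>bra_space M. Mbc_dual M (phase_C M s v) = fermi_C M x (Mbc_dual M v)))"
proof -
  have "s \<noteq> 0" using assms(2,3) by auto
  then have phase: "phase_B M s = strip x M" "phase_C M s = strip x M"
    using assms(3) by (simp_all add: fun_eq_iff phase_B_eq_strip phase_C_eq_strip)
  have bra: "bra_space M = (ket_space M :: 'k ket set)"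
    by (simp add: bra_space_def ket_space_def)
  show ?thesis
    unfolding phase bra dual_fock0_eq
    by (auto simp: strip_ket_space Mbc_fock0 fermi_B_fock0 Mbc_strip Mbc_dual_eq fermi_C_mirror)
qed

end
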